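(* Over the standard structure $\mathbb{N}$ of arithmetic, a relation $X\subseteq\mathbb{N}^k$ is definable by a formula of $\mathrm{SCL}$ (i.e., there is $\varphi(x_1,\dots,x_k)$ of $\mathrm{SCL}$ with $(m_1,\dots,m_k)\in X$ iff $\mathbb{N},[m_i/x_i]\models\varphi$) if and only if $X$ is a $\Pi^1_1$-relation.
   Context: A relation $X\subseteq\mathbb{N}^k$ is $\Pi^1_1$ if there is a formula $\forall X_1\dots\forall X_n\,\psi(x_1,\dots,x_k)$ of universal second-order logic ($X_i$ relation variables, $\psi$ first-order) over the vocabulary of arithmetic such that $(m_1,\dots,m_k)\in X$ iff $\mathbb{N}\models\forall X_1\dots\forall X_n\,\psi(m_1,\dots,m_k)$. Syntax of $\mathrm{SCL}$. $\mathrm{FO}$ has equality and $\bot$ as primitives and $\neg,\wedge,\vee,\exists,\forall$. Fix label symbols $L_0,L_1,\dots$ and for each $L$ a claim symbol $C_L$. Formulas: $\mathrm{FO}$ formation rules plus: each $C_L$ is atomic (no free variables); if $\varphi$ is a formula, $L\varphi$ is a formula (same free variables). FO-atoms are atomic formulas of $\mathrm{FO}$. The reference formula of an occurrence of $C_L$ is the subformula occurrence $L\psi$ above it in the syntax tree with no occurrence of $L$ strictly between (if any). Semantics. $\mathcal{G}_\infty(\mathfrak{A},s,\varphi)$ has positions $(\psi,r,\#)$, $\#\in\{+,-\}$, starting at $(\varphi,s,+)$. FO-atom $\alpha$: if $\#=+$ Eloise wins iff $\mathfrak{A},r\models\alpha$, else Abelard; if $\#=-$ Abelard wins iff $\mathfrak{A},r\models\alpha$,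 else Eloise. $\neg$ flips the sign. $\wedge$: Abelard chooses if $+$, Eloise if $-$. $\vee$: Eloise if $+$, Abelard if $-$. $\forall x$: Abelard picks $a\in A$ if $+$, Eloise if $-$, assignment becomes $r[a/x]$. $\exists x$: Eloise if $+$, Abelard if $-$. $L\psi$: move to $\psi$. $C_L$: move to its reference formula (no winner if none). Infinite plays have no winner. $\mathfrak{A},s\models\varphi$ iff Eloise has a winning strategy. *)

theory Defs
  imports Main "HOL-Library.Sublist"
begin

section \<open>Terms and first-order atoms of arithmetic\<close>

text \<open>
  The vocabulary of arithmetic is taken to be \<open>0, 1, +, \<cdot>, <\<close>. Variables are
  natural numbers; the variable \<open>x\<^sub>i\<close> (for \<open>1 \<le> i \<le> k\<close>) is the number \<open>i - 1\<close>.
\<close>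

datatype tm = Var nat | Zero | One | Add tm tm | Mult tm tm

datatype atom = Bot | Equal tm tm | Less tm tm

type_synonym asg = "nat \<Rightarrow> nat"

primrec tm_val :: "asg \<Rightarrow> tm \<Rightarrow> nat" where
  "tm_val s (Var x) = s x"
| "tm_val s Zero = 0"
| "tm_val s One = 1"
| "tm_val s (Add t u) = tm_val s t + tm_val s u"
| "tm_val s (Mult t u) = tm_val s t * tm_val s u"

primrec atom_sat :: "asg \<Rightarrow> atom \<Rightarrow> bool" where
  "atom_sat s Bot \<longleftrightarrow> False"
| "atom_sat s (Equal t u) \<longleftrightarrow> tm_val s t = tm_val s u"
| "atom_sat s (Less t u) \<longleftrightarrow> tm_val s t < tm_val s u"

primrec tm_fv :: "tm \<Rightarrow> nat set" where
  "tm_fv (Var x) = {x}"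
| "tm_fv Zero = {}"
| "tm_fv One = {}"
| "tm_fv (Add t u) = tm_fv t \<union> tm_fv u"
| "tm_fv (Mult t u) = tm_fv t \<union> tm_fv u"

primrec atom_fv :: "atom \<Rightarrow> nat set" where
  "atom_fv Bot = {}"
| "atom_fv (Equal t u) = tm_fv t \<union> tm_fv u"
| "atom_fv (Less t u) = tm_fv t \<union> tm_fv u"

text \<open>
  The assignment \<open>[m\<^sub>i/x\<^sub>i]\<close>. Assignments are total; the value 0 beyond the tuple is
  irrelevant, because the formulas evaluated have no free variables there.
\<close>

definition tuple_asg :: "nat list \<Rightarrow> asg" where
  "tuple_asg m = (\<lambda>i. if i < length m then m ! i else 0)"


section \<open>Universal second-order logic over the natural numbers\<close>

text \<open>A relation variable carries its arity.\<close>

datatype rvar = RVar nat (arity: nat)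

datatype fo =
    FAtom atom
  | FRel rvar "tm list"
  | FNeg fo
  | FConj fo fo
  | FDisj fo fo
  | FForall nat fo
  | FExists nat fo

datatype uso = Matrix fo | ForallRel rvar uso

type_synonym rel_asg = "rvar \<Rightarrow> nat list set"

primrec fo_sat :: "rel_asg \<Rightarrow> asg \<Rightarrow> fo \<Rightarrow> bool" where
  "fo_sat I s (FAtom a) \<longleftrightarrow> atom_sat s a"
| "fo_sat I s (FRel X ts) \<longleftrightarrow> map (tm_val s) ts \<in> I X"
| "fo_sat I s (FNeg \<phi>) \<longleftrightarrow> \<not> fo_sat I s \<phi>"
| "fo_sat I s (FConj \<phi> \<psi>) \<longleftrightarrow> fo_sat I s \<phi> \<and> fo_sat I s \<psi>"
| "fo_sat I s (FDisj \<phi> \<psi>) \<longleftrightarrow> fo_sat I s \<phi> \<or> fo_sat I s \<psi>"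
| "fo_sat I s (FForall x \<phi>) \<longleftrightarrow> (\<forall>a. fo_sat I (s(x := a)) \<phi>)"
| "fo_sat I s (FExists x \<phi>) \<longleftrightarrow> (\<exists>a. fo_sat I (s(x := a)) \<phi>)"

primrec uso_sat :: "rel_asg \<Rightarrow> asg \<Rightarrow> uso \<Rightarrow> bool" where
  "uso_sat I s (Matrix \<psi>) \<longleftrightarrow> fo_sat I s \<psi>"
| "uso_sat I s (ForallRel X \<Phi>) \<longleftrightarrow>
    (\<forall>R \<subseteq> {v. length v = arity X}. uso_sat (I(X := R)) s \<Phi>)"

primrec fo_fv :: "fo \<Rightarrow> nat set" where
  "fo_fv (FAtom a) = atom_fv a"
| "fo_fv (FRel X ts) = (\<Union>t\<in>set ts. tm_fv t)"
| "fo_fv (FNeg \<phi>) = fo_fv \<phi>"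
| "fo_fv (FConj \<phi> \<psi>) = fo_fv \<phi> \<union> fo_fv \<psi>"
| "fo_fv (FDisj \<phi> \<psi>) = fo_fv \<phi> \<union> fo_fv \<psi>"
| "fo_fv (FForall x \<phi>) = fo_fv \<phi> - {x}"
| "fo_fv (FExists x \<phi>) = fo_fv \<phi> - {x}"

primrec uso_fv :: "uso \<Rightarrow> nat set" where
  "uso_fv (Matrix \<psi>) = fo_fv \<psi>"
| "uso_fv (ForallRel X \<Phi>) = uso_fv \<Phi>"

primrec fo_rvars :: "fo \<Rightarrow> rvar set" where
  "fo_rvars (FAtom a) = {}"
| "fo_rvars (FRel X ts) = {X}"
| "fo_rvars (FNeg \<phi>) = fo_rvars \<phi>"
| "fo_rvars (FConj \<phi> \<psi>) = fo_rvars \<phi> \<union> fo_rvars \<psi>"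
| "fo_rvars (FDisj \<phi> \<psi>) = fo_rvars \<phi> \<union> fo_rvars \<psi>"
| "fo_rvars (FForall x \<phi>) = fo_rvars \<phi>"
| "fo_rvars (FExists x \<phi>) = fo_rvars \<phi>"

primrec uso_free_rvars :: "uso \<Rightarrow> rvar set" where
  "uso_free_rvars (Matrix \<psi>) = fo_rvars \<psi>"
| "uso_free_rvars (ForallRel X \<Phi>) = uso_free_rvars \<Phi> - {X}"

primrec fo_wf :: "fo \<Rightarrow> bool" where
  "fo_wf (FAtom a) \<longleftrightarrow> True"
| "fo_wf (FRel X ts) \<longleftrightarrow> length ts = arity X"
| "fo_wf (FNeg \<phi>) \<longleftrightarrow> fo_wf \<phi>"
| "fo_wf (FConj \<phi> \<psi>) \<longleftrightarrow> fo_wf \<phi> \<and> fo_wf \<psi>"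
| "fo_wf (FDisj \<phi> \<psi>) \<longleftrightarrow> fo_wf \<phi> \<and> fo_wf \<psi>"
| "fo_wf (FForall x \<phi>) \<longleftrightarrow> fo_wf \<phi>"
| "fo_wf (FExists x \<phi>) \<longleftrightarrow> fo_wf \<phi>"

primrec uso_wf :: "uso \<Rightarrow> bool" where
  "uso_wf (Matrix \<psi>) \<longleftrightarrow> fo_wf \<psi>"
| "uso_wf (ForallRel X \<Phi>) \<longleftrightarrow> uso_wf \<Phi>"

text \<open>
  A \<open>k\<close>-ary relation is a set of lists of length \<open>k\<close>. The relation assignment
  \<open>\<lambda>_. {}\<close> is a dummy, since all relation variables are quantified.
\<close>

definition Pi11_relation :: "nat \<Rightarrow> nat list set \<Rightarrow> bool" where
  "Pi11_relation k X \<longleftrightarrow>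
    (\<exists>\<Phi>. uso_wf \<Phi> \<and> uso_free_rvars \<Phi> = {} \<and> uso_fv \<Phi> \<subseteq> {..<k} \<and>
      (\<forall>m. length m = k \<longrightarrow> (m \<in> X \<longleftrightarrow> uso_sat (\<lambda>_. {}) (tuple_asg m) \<Phi>)))"


section \<open>Two-player games with possibly infinite plays\<close>

datatype player = Eloise | Abelard

text \<open>
  \<open>turn p = None\<close> means that no player chooses at \<open>p\<close> (the play ends or its
  continuation is forced); \<open>winner p\<close> is the winner of a play that ends at \<open>p\<close>,
  if there is one. Infinite plays have no winner.
\<close>

record 'p game =
  start :: 'p
  moves :: "'p \<Rightarrow> 'p set"
  turn :: "'p \<Rightarrow> player option"
  winner :: "'p \<Rightarrow> player option"

type_synonym 'p strategy = "'p list \<Rightarrow> 'p"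

definition play_prefix :: "'p game \<Rightarrow> 'p strategy \<Rightarrow> 'p list \<Rightarrow> bool" where
  "play_prefix G \<sigma> h \<longleftrightarrow> h \<noteq> [] \<and> hd h = start G \<and>
    (\<forall>i. Suc i < length h \<longrightarrow>
      h ! Suc i \<in> moves G (h ! i) \<and>
      (turn G (h ! i) = Some Eloise \<longrightarrow> h ! Suc i = \<sigma> (take (Suc i) h)))"

definition infinite_play :: "'p game \<Rightarrow> 'p strategy \<Rightarrow> (nat \<Rightarrow> 'p) \<Rightarrow> bool" where
  "infinite_play G \<sigma> f \<longleftrightarrow> f 0 = start G \<and>
    (\<forall>i. f (Suc i) \<in> moves G (f i) \<and>
      (turn G (f i) = Some Eloise \<longrightarrow> f (Suc i) = \<sigma> (map f [0..<Suc i])))"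

text \<open>
  The first conjunct makes \<open>\<sigma>\<close> prescribe legal moves, the other two say that every
  play in which Eloise follows \<open>\<sigma>\<close> ends and is won by her.
\<close>

definition winning_strategy :: "'p game \<Rightarrow> 'p strategy \<Rightarrow> bool" where
  "winning_strategy G \<sigma> \<longleftrightarrow>
    (\<forall>h. play_prefix G \<sigma> h \<and> turn G (last h) = Some Eloise \<longrightarrow> \<sigma> h \<in> moves G (last h)) \<and>
    (\<forall>h. play_prefix G \<sigma> h \<and> moves G (last h) = {} \<longrightarrow> winner G (last h) = Some Eloise) \<and>
    (\<nexists>f. infinite_play G \<sigma> f)"


section \<open>The logic SCL\<close>

text \<open>Label symbols \<open>L\<^sub>0, L\<^sub>1, \<dots>\<close> are represented by their indices.\<close>

datatype scl =
    Atom atom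
  | Neg scl
  | Conj scl scl
  | Disj scl scl
  | Forall nat scl
  | Exists nat scl
  | Label nat scl
  | Claim nat

primrec scl_fv :: "scl \<Rightarrow> nat set" where
  "scl_fv (Atom a) = atom_fv a"
| "scl_fv (Neg \<phi>) = scl_fv \<phi>"
| "scl_fv (Conj \<phi> \<psi>) = scl_fv \<phi> \<union> scl_fv \<psi>"
| "scl_fv (Disj \<phi> \<psi>) = scl_fv \<phi> \<union> scl_fv \<psi>"
| "scl_fv (Forall x \<phi>) = scl_fv \<phi> - {x}"
| "scl_fv (Exists x \<phi>) = scl_fv \<phi> - {x}"
| "scl_fv (Label L \<phi>) = scl_fv \<phi>"
| "scl_fv (Claim L) = {}"

text \<open>
  Subformula occurrences are addressed by the path of child indices leading to them
  from the root of the syntax tree.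
\<close>

type_synonym addr = "nat list"

fun children :: "scl \<Rightarrow> scl list" where
  "children (Atom a) = []"
| "children (Neg \<phi>) = [\<phi>]"
| "children (Conj \<phi> \<psi>) = [\<phi>, \<psi>]"
| "children (Disj \<phi> \<psi>) = [\<phi>, \<psi>]"
| "children (Forall x \<phi>) = [\<phi>]"
| "children (Exists x \<phi>) = [\<phi>]"
| "children (Label L \<phi>) = [\<phi>]"
| "children (Claim L) = []"

fun subformula_at :: "scl \<Rightarrow> addr \<Rightarrow> scl option" where
  "subformula_at \<phi> [] = Some \<phi>"
| "subformula_at \<phi> (i # p) =
    (if i < length (children \<phi>) then subformula_at (children \<phi> ! i) p else None)"

definition labelled_at :: "scl \<Rightarrow> nat \<Rightarrow> addr \<Rightarrow> bool" where
  "labelled_at \<phi> L q \<longleftrightarrow> (\<exists>\<psi>. subformula_at \<phi> q = Some (Label L \<psi>))"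

text \<open>\<open>q\<close> is the address of the reference formula of the occurrence of \<open>C\<^sub>L\<close> at \<open>p\<close>.\<close>

definition reference :: "scl \<Rightarrow> nat \<Rightarrow> addr \<Rightarrow> addr \<Rightarrow> bool" where
  "reference \<phi> L p q \<longleftrightarrow> strict_prefix q p \<and> labelled_at \<phi> L q \<and>
    (\<forall>q'. strict_prefix q q' \<and> strict_prefix q' p \<longrightarrow> \<not> labelled_at \<phi> L q')"

datatype sign = Plus | Minus

primrec flip :: "sign \<Rightarrow> sign" where
  "flip Plus = Minus"
| "flip Minus = Plus"

text \<open>The player who defends the formula at a position with the given sign.\<close>

primrec verifier :: "sign \<Rightarrow> player" where
  "verifier Plus = Eloise"
| "verifier Minus = Abelard"

primrec falsifier :: "sign \<Rightarrow> player" where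
  "falsifier Plus = Abelard"
| "falsifier Minus = Eloise"

type_synonym pos = "addr \<times> asg \<times> sign"

fun scl_moves :: "scl \<Rightarrow> pos \<Rightarrow> pos set" where
  "scl_moves \<phi> (p, r, sg) =
    (case subformula_at \<phi> p of
       None \<Rightarrow> {}
     | Some (Atom a) \<Rightarrow> {}
     | Some (Neg \<psi>) \<Rightarrow> {(p @ [0], r, flip sg)}
     | Some (Conj \<psi> \<chi>) \<Rightarrow> {(p @ [0], r, sg), (p @ [1], r, sg)}
     | Some (Disj \<psi> \<chi>) \<Rightarrow> {(p @ [0], r, sg), (p @ [1], r, sg)}
     | Some (Forall x \<psi>) \<Rightarrow> {(p @ [0], r(x := a), sg) | a. True}
     | Some (Exists x \<psi>) \<Rightarrow> {(p @ [0], r(x := a), sg) | a. True}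
     | Some (Label L \<psi>) \<Rightarrow> {(p @ [0], r, sg)}
     | Some (Claim L) \<Rightarrow> {(q, r, sg) | q. reference \<phi> L p q})"

fun scl_turn :: "scl \<Rightarrow> pos \<Rightarrow> player option" where
  "scl_turn \<phi> (p, r, sg) =
    (case subformula_at \<phi> p of
       Some (Conj \<psi> \<chi>) \<Rightarrow> Some (falsifier sg)
     | Some (Disj \<psi> \<chi>) \<Rightarrow> Some (verifier sg)
     | Some (Forall x \<psi>) \<Rightarrow> Some (falsifier sg)
     | Some (Exists x \<psi>) \<Rightarrow> Some (verifier sg)
     | _ \<Rightarrow> None)"

fun scl_winner :: "scl \<Rightarrow> pos \<Rightarrow> player option" where
  "scl_winner \<phi> (p, r, sg) =
    (case subformula_at \<phi> p of
       Some (Atom a) \<Rightarrow> Some (if atom_sat r a then verifier sg else falsifier sg)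
     | _ \<Rightarrow> None)"

definition scl_game :: "asg \<Rightarrow> scl \<Rightarrow> pos game" where
  "scl_game s \<phi> =
    \<lparr>start = ([], s, Plus), moves = scl_moves \<phi>, turn = scl_turn \<phi>, winner = scl_winner \<phi>\<rparr>"

definition scl_sat :: "asg \<Rightarrow> scl \<Rightarrow> bool" where
  "scl_sat s \<phi> \<longleftrightarrow> (\<exists>\<sigma>. winning_strategy (scl_game s \<phi>) \<sigma>)"

definition SCL_definable :: "nat \<Rightarrow> nat list set \<Rightarrow> bool" where
  "SCL_definable k X \<longleftrightarrow>
    (\<exists>\<phi>. scl_fv \<phi> \<subseteq> {..<k} \<and>
      (\<forall>m. length m = k \<longrightarrow> (m \<in> X \<longleftrightarrow> scl_sat (tuple_asg m) \<phi>)))"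

end

theory Submission
  imports Defs "HOL-Library.Countable" "HOL-Number_Theory.Cong"
begin

text \<open>
  The set of positions won by Eloise is the least set closed under forcing in one move, so the start
  position is winning iff it belongs to every closed set. As there are only finitely many
  subformula occurrences and variables, this is a universal statement about a single relation.

  Conversely, a formula \<open>\<forall>X\<^sub>1\<dots>\<forall>X\<^sub>n \<psi>\<close> fails iff some sequence \<open>f\<close> of numbers codes relations, the truth
  values of all subformulas of \<open>\<psi>\<close> under all assignments and witnesses of the true existential ones,
  makes \<open>\<psi>\<close> false, and satisfies all local truth conditions, each of which concerns at most three entries
  of \<open>f\<close>. In the game Abelard has to reveal longer and longer initial segments of such a sequence, coded by
  Goedel's beta function, and Eloise wins as soon as a local condition is violated. Since infinite
  plays are not won by Eloise, she wins iff no such \<open>f\<close> exists.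
\<close>

section \<open>Winning positions as a least fixed point\<close>

text \<open>SCL has no memory but the current assignment. It survives jumps: a claim carries the
  values of bound variables out of the scope of their quantifiers. So in one direction a position
  must list all variables, bound ones included, and in the other the state of the game can live in a
  few extra variables.

  Two obstacles shape the second direction. Initial segments of unbounded length must fit into a
  fixed number of variables, hence the beta function. Its parameters for a longer segment are
  unrelated to those for a shorter one, so Abelard names new ones in every round and Eloise may
  challenge their agreement with the saved old ones. Moreover, each defect of a sequence must show
  in finitely many entries. Finitely many false instances do not refute an existential formula; once
  its entry names a witness, a single false instance does.\<close>

definition game_step :: "'p game \<Rightarrow> ('p \<Rightarrow> bool) \<Rightarrow> 'p \<Rightarrow> bool" where
  "game_step G S p \<longleftrightarrow>
    (if turn G p = Some Eloise then \<exists>q\<in>moves G p. S q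
     else (\<forall>q\<in>moves G p. S q) \<and> (moves G p = {} \<longrightarrow> winner G p = Some Eloise))"

text \<open>Least, since a play that never ends is not won by Eloise.\<close>

definition wins :: "'p game \<Rightarrow> 'p \<Rightarrow> bool" where
  "wins G = lfp (game_step G)"

lemma mono_game_step: "mono (game_step G)"
  by (rule monoI) (auto simp: game_step_def le_fun_def)

lemma wins_unfold: "wins G p \<longleftrightarrow> game_step G (wins G) p"
  unfolding wins_def using lfp_unfold[OF mono_game_step[of G]] by metis

lemma wins_least:
  assumes "\<And>p. game_step G S p \<Longrightarrow> S p" and "wins G p"
  shows "S p"
proof -
  have "lfp (game_step G) \<le> S"
    by (rule lfp_lowerbound) (use assms(1) in auto)
  with assms(2) show ?thesis by (auto simp: wins_def)
qed

text \<open>A history that follows \<open>\<sigma>\<close> and ends outside \<open>wins\<close> can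
  be prolonged by one position of the same kind. Iterating this from the start would give an
  infinite play.\<close>

lemma winning_strategy_imp_wins:
  assumes ws: "winning_strategy G \<sigma>"
  shows "wins G (start G)"
proof (rule ccontr)
  assume neg: "\<not> wins G (start G)"
  define P where "P h \<longleftrightarrow> play_prefix G \<sigma> h \<and> \<not> wins G (last h)" for h
  have "\<exists>h'. P h' \<and> (\<exists>q. h' = h @ [q])" if "P h" for h
  proof -
    let ?p = "last h"
    from that have pp: "play_prefix G \<sigma> h" and nw: "\<not> game_step G (wins G) ?p"
      by (auto simp: P_def wins_unfold[symmetric])
    then have ne: "h \<noteq> []" by (simp add: play_prefix_def)
    obtain q where q: "q \<in> moves G ?p" "turn G ?p = Some Eloise \<longrightarrow> q = \<sigma> h" "\<not> wins G q"
    proof (cases "turn G ?p = Some Eloise")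
      case True
      with ws pp have "\<sigma> h \<in> moves G ?p" by (auto simp: winning_strategy_def)
      with True nw that show ?thesis by (auto simp: game_step_def)
    next
      case False
      moreover have "moves G ?p = {} \<longrightarrow> winner G ?p = Some Eloise"
        using ws pp by (auto simp: winning_strategy_def)
      ultimately show ?thesis using nw that by (auto simp: game_step_def)
    qed
    have "play_prefix G \<sigma> (h @ [q])"
      unfolding play_prefix_def
    proof (intro conjI allI impI)
      fix i assume i: "Suc i < length (h @ [q])"
      show "(h @ [q]) ! Suc i \<in> moves G ((h @ [q]) ! i)"
      proof (cases "Suc i < length h")
        case True then show ?thesis using pp by (auto simp: play_prefix_def nth_append)
      next
        case False
        with i have "i = length h - 1" "Suc i = length h" by auto
        then show ?thesis using q ne by (auto simp: nth_append last_conv_nth)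
      qed
      assume t: "turn G ((h @ [q]) ! i) = Some Eloise"
      show "(h @ [q]) ! Suc i = \<sigma> (take (Suc i) (h @ [q]))"
      proof (cases "Suc i < length h")
        case True then show ?thesis using pp t by (auto simp: play_prefix_def nth_append)
      next
        case False
        with i have "i = length h - 1" "Suc i = length h" by auto
        then show ?thesis using q ne t by (auto simp: nth_append last_conv_nth)
      qed
    qed (use pp ne in \<open>auto simp: play_prefix_def\<close>)
    with q show ?thesis by (auto simp: P_def)
  qed
  then obtain T where T: "\<And>h. P h \<Longrightarrow> P (T h) \<and> (\<exists>q. T h = h @ [q])" by metis
  define H where "H n = (T ^^ n) [start G]" for n
  have H0: "H 0 = [start G]" by (simp add: H_def)
  have HP: "P (H n)" for n
    by (induction n) (use neg T in \<open>auto simp: H_def P_def play_prefix_def\<close>)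
  have HS: "\<exists>q. H (Suc n) = H n @ [q]" for n
    using T[OF HP[of n]] by (simp add: H_def)
  define f where "f n = last (H n)" for n
  have Hf: "H n = map f [0..<Suc n]" for n
  proof (induction n)
    case 0 then show ?case by (simp add: H0 f_def)
  next
    case (Suc n)
    from HS[of n] obtain q where q: "H (Suc n) = H n @ [q]" by auto
    then have "f (Suc n) = q" by (simp add: f_def)
    with q Suc show ?case by simp
  qed
  have "infinite_play G \<sigma> f"
    unfolding infinite_play_def
  proof (intro conjI allI impI)
    show "f 0 = start G" by (simp add: f_def H0)
  next
    fix i
    have "play_prefix G \<sigma> (map f [0..<Suc (Suc i)])" using HP[of "Suc i"] by (simp add: P_def Hf)
    then have "map f [0..<Suc (Suc i)] ! Suc i \<in> moves G (map f [0..<Suc (Suc i)] ! i) \<and>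
      (turn G (map f [0..<Suc (Suc i)] ! i) = Some Eloise \<longrightarrow>
        map f [0..<Suc (Suc i)] ! Suc i = \<sigma> (take (Suc i) (map f [0..<Suc (Suc i)])))"
      unfolding play_prefix_def by (metis length_map length_upt diff_zero lessI)
    then show "f (Suc i) \<in> moves G (f i)"
      and "turn G (f i) = Some Eloise \<Longrightarrow> f (Suc i) = \<sigma> (map f [0..<Suc i])"
      by (simp_all del: upt_Suc add: nth_append take_map)
  qed
  with ws show False by (auto simp: winning_strategy_def)
qed

text \<open>Strategies see whole histories, so dropping the first position changes their argument.
  \<open>\<tau>\<close> has to match \<open>\<sigma>\<close> only on histories beginning with
  \<open>hd h\<close>: a glued strategy may thus choose its continuation by the second
  position.\<close>

lemma play_prefix_tl:
  assumes "play_prefix (G\<lparr>start := p\<rparr>) \<sigma> (p # h)" and "h \<noteq> []"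
    and "\<And>h'. h' \<noteq> [] \<Longrightarrow> hd h' = hd h \<Longrightarrow> \<sigma> (p # h') = \<tau> h'"
  shows "hd h \<in> moves G p" "turn G p = Some Eloise \<Longrightarrow> hd h = \<sigma> [p]"
    "play_prefix (G\<lparr>start := hd h\<rparr>) \<tau> h"
proof -
  have *: "(p # h) ! Suc i \<in> moves G ((p # h) ! i) \<and>
      (turn G ((p # h) ! i) = Some Eloise \<longrightarrow> (p # h) ! Suc i = \<sigma> (take (Suc i) (p # h)))"
    if "i < length h" for i
    using assms(1) that by (auto simp: play_prefix_def)
  show "hd h \<in> moves G p" "turn G p = Some Eloise \<Longrightarrow> hd h = \<sigma> [p]"
    using *[of 0] assms(2) by (auto simp: hd_conv_nth)
  show "play_prefix (G\<lparr>start := hd h\<rparr>) \<tau> h"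
    unfolding play_prefix_def
  proof (intro conjI allI impI)
    fix i assume i: "Suc i < length h"
    show "h ! Suc i \<in> moves (G\<lparr>start := hd h\<rparr>) (h ! i)"
      using *[of "Suc i"] i by simp
    assume "turn (G\<lparr>start := hd h\<rparr>) (h ! i) = Some Eloise"
    then have "h ! Suc i = \<sigma> (p # take (Suc i) h)" using *[of "Suc i"] i by simp
    also have "\<dots> = \<tau> (take (Suc i) h)" using assms(2) by (intro assms(3)) auto
    finally show "h ! Suc i = \<tau> (take (Suc i) h)" .
  qed (use assms in auto)
qed

text \<open>Strategies for the successors of \<open>p\<close> are glued along the first move.\<close>

lemma winning_strategy_glue:
  assumes win: "\<And>q. q \<in> Q \<Longrightarrow> winning_strategy (G\<lparr>start := q\<rparr>) (\<tau> q)"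
    and Q: "\<And>q. q \<in> moves G p \<Longrightarrow> (turn G p = Some Eloise \<longrightarrow> q = q0) \<Longrightarrow> q \<in> Q"
    and q0: "turn G p = Some Eloise \<Longrightarrow> q0 \<in> moves G p"
    and stuck: "moves G p = {} \<Longrightarrow> winner G p = Some Eloise"
  shows "winning_strategy (G\<lparr>start := p\<rparr>) (\<lambda>h. if tl h = [] then q0 else \<tau> (hd (tl h)) (tl h))"
    (is "winning_strategy ?G ?\<sigma>")
proof -
  have tail: "hd h \<in> Q \<and> play_prefix (G\<lparr>start := hd h\<rparr>) (\<tau> (hd h)) h"
    if pp: "play_prefix ?G ?\<sigma> (p # h)" and "h \<noteq> []" for h
  proof -
    have "\<And>h'. h' \<noteq> [] \<Longrightarrow> hd h' = hd h \<Longrightarrow> ?\<sigma> (p # h') = \<tau> (hd h) h'" by auto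
    from play_prefix_tl[OF that this] Q show ?thesis by auto
  qed
  have shape: "\<exists>h'. h = p # h'" if "play_prefix ?G ?\<sigma> h" for h
    using that by (cases h) (auto simp: play_prefix_def)
  show ?thesis
    unfolding winning_strategy_def
  proof (intro conjI allI impI notI)
    fix h assume h: "play_prefix ?G ?\<sigma> h \<and> turn ?G (last h) = Some Eloise"
    with shape obtain h' where h': "h = p # h'" by auto
    show "?\<sigma> h \<in> moves ?G (last h)"
    proof (cases "h' = []")
      case True then show ?thesis using h h' q0 by auto
    next
      case False
      with tail h h' win show ?thesis by (auto simp: winning_strategy_def)
    qed
  next
    fix h assume h: "play_prefix ?G ?\<sigma> h \<and> moves ?G (last h) = {}"
    with shape obtain h' where h': "h = p # h'" by auto
    show "winner ?G (last h) = Some Eloise"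
    proof (cases "h' = []")
      case True then show ?thesis using h h' stuck by auto
    next
      case False
      with tail h h' win show ?thesis by (auto simp: winning_strategy_def)
    qed
  next
    assume "\<exists>f. infinite_play ?G ?\<sigma> f"
    then obtain f where f0: "f 0 = p"
      and f: "\<And>i. f (Suc i) \<in> moves G (f i)"
        "\<And>i. turn G (f i) = Some Eloise \<Longrightarrow> f (Suc i) = ?\<sigma> (map f [0..<Suc i])"
      unfolding infinite_play_def by auto
    have Q1: "f 1 \<in> Q" using f[of 0] f0 by (intro Q) auto
    have "infinite_play (G\<lparr>start := f 1\<rparr>) (\<tau> (f 1)) (\<lambda>i. f (Suc i))"
      unfolding infinite_play_def
    proof (intro conjI allI impI)
      fix i assume "turn (G\<lparr>start := f 1\<rparr>) (f (Suc i)) = Some Eloise"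
      then have "f (Suc (Suc i)) = ?\<sigma> (map f [0..<Suc (Suc i)])" by (intro f) simp
      also have "map f [0..<Suc (Suc i)] = p # map (\<lambda>i. f (Suc i)) [0..<Suc i]"
        by (simp only: map_upt_Suc) (simp add: f0)
      also have "?\<sigma> \<dots> = \<tau> (f 1) (map (\<lambda>i. f (Suc i)) [0..<Suc i])"
        by (simp add: hd_map hd_append del: upt_Suc)
      finally show "f (Suc (Suc i)) = \<tau> (f 1) (map (\<lambda>i. f (Suc i)) [0..<Suc i])" .
    qed (use f(1) in simp_all)
    with win[OF Q1] show False by (auto simp: winning_strategy_def)
  qed
qed

text \<open>The positions with a winning strategy are closed under \<open>game_step\<close>, by
  gluing, so they include \<open>wins\<close>.\<close>

lemma wins_imp_winning_strategy:
  assumes "wins G p"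
  shows "\<exists>\<sigma>. winning_strategy (G\<lparr>start := p\<rparr>) \<sigma>"
  using _ assms
proof (rule wins_least)
  fix p assume st: "game_step G (\<lambda>p. \<exists>\<sigma>. winning_strategy (G\<lparr>start := p\<rparr>) \<sigma>) p"
  define Q where "Q = {q. \<exists>\<sigma>. winning_strategy (G\<lparr>start := q\<rparr>) \<sigma>}"
  have "\<exists>\<tau>. \<forall>q\<in>Q. winning_strategy (G\<lparr>start := q\<rparr>) (\<tau> q)"
    by (rule bchoice) (simp add: Q_def)
  then obtain \<tau> where \<tau>: "\<And>q. q \<in> Q \<Longrightarrow> winning_strategy (G\<lparr>start := q\<rparr>) (\<tau> q)" by auto
  have st': "game_step G (\<lambda>q. q \<in> Q) p" using st by (simp add: Q_def)
  show "\<exists>\<sigma>. winning_strategy (G\<lparr>start := p\<rparr>) \<sigma>"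
  proof (cases "turn G p = Some Eloise")
    case True
    with st' obtain q where "q \<in> moves G p" "q \<in> Q" by (auto simp: game_step_def)
    with True show ?thesis
      by (intro exI[of _ "\<lambda>h. if tl h = [] then q else \<tau> (hd (tl h)) (tl h)"]
          winning_strategy_glue[where Q = Q]) (use \<tau> in auto)
  next
    case False
    with st' show ?thesis
      by (intro exI[of _ "\<lambda>h. if tl h = [] then p else \<tau> (hd (tl h)) (tl h)"]
          winning_strategy_glue[where Q = Q]) (use \<tau> in \<open>auto simp: game_step_def\<close>)
  qed
qed

lemma ex_winning_strategy_iff_wins: "(\<exists>\<sigma>. winning_strategy G \<sigma>) \<longleftrightarrow> wins G (start G)"
  using winning_strategy_imp_wins wins_imp_winning_strategy[of G "start G"] by force

section \<open>The game of SCL and its winning positions\<close>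

lemma subformula_at_append:
  "subformula_at \<phi> (p @ q) = Option.bind (subformula_at \<phi> p) (\<lambda>\<psi>. subformula_at \<psi> q)"
  by (induction \<phi> p rule: subformula_at.induct) auto

text \<open>Prefixes of \<open>p\<close> are comparable; if the two differed, the longer would be a
  labelled node strictly between the shorter and \<open>p\<close>.\<close>

lemma reference_unique:
  assumes "reference \<phi> L p q" and "reference \<phi> L p q'"
  shows "q = q'"
proof -
  from assms have "strict_prefix q p" "strict_prefix q' p"
    "\<not> strict_prefix q q'" "\<not> strict_prefix q' q"
    by (auto simp: reference_def)
  then show ?thesis
    by (metis prefix_order.less_le prefix_same_cases)
qed

text \<open>The existential clause for claims makes a claim without reference formula not winning;
  otherwise \<open>reference_unique\<close> makes it the forced move.\<close>

definition scl_step :: "scl \<Rightarrow> (pos \<Rightarrow> bool) \<Rightarrow> addr \<Rightarrow> asg \<Rightarrow> sign \<Rightarrow> bool" where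
  "scl_step \<phi> S p r sg =
    (case subformula_at \<phi> p of
       None \<Rightarrow> False
     | Some (Atom a) \<Rightarrow> (sg = Plus) = atom_sat r a
     | Some (Neg \<psi>) \<Rightarrow> S (p @ [0], r, flip sg)
     | Some (Conj \<psi> \<chi>) \<Rightarrow>
         (if sg = Plus then S (p @ [0], r, sg) \<and> S (p @ [1], r, sg)
          else S (p @ [0], r, sg) \<or> S (p @ [1], r, sg))
     | Some (Disj \<psi> \<chi>) \<Rightarrow>
         (if sg = Plus then S (p @ [0], r, sg) \<or> S (p @ [1], r, sg)
          else S (p @ [0], r, sg) \<and> S (p @ [1], r, sg))
     | Some (Forall x \<psi>) \<Rightarrow>
         (if sg = Plus then \<forall>a. S (p @ [0], r(x := a), sg) else \<exists>a. S (p @ [0], r(x := a), sg))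
     | Some (Exists x \<psi>) \<Rightarrow>
         (if sg = Plus then \<exists>a. S (p @ [0], r(x := a), sg) else \<forall>a. S (p @ [0], r(x := a), sg))
     | Some (Label L \<psi>) \<Rightarrow> S (p @ [0], r, sg)
     | Some (Claim L) \<Rightarrow> \<exists>q. reference \<phi> L p q \<and> S (q, r, sg))"

lemma game_step_scl: "game_step (scl_game s \<phi>) S (p, r, sg) \<longleftrightarrow> scl_step \<phi> S p r sg"
proof (cases "subformula_at \<phi> p")
  case (Some \<psi>)
  then show ?thesis
    by (cases \<psi>; cases sg)
      (auto simp: game_step_def scl_step_def scl_game_def dest: reference_unique)
qed (auto simp: game_step_def scl_step_def scl_game_def)

text \<open>The starting assignment is a dummy: the winning positions do not depend on it.\<close>

abbreviation "scl_wins \<equiv> \<lambda>\<phi> p r sg. wins (scl_game (\<lambda>_. 0) \<phi>) (p, r, sg)"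

lemma wins_scl_game: "wins (scl_game s \<phi>) = wins (scl_game s' \<phi>)"
proof -
  have "game_step (scl_game s \<phi>) = game_step (scl_game s' \<phi>)"
    by (intro ext) (simp add: game_step_def scl_game_def)
  then show ?thesis by (simp add: wins_def)
qed

lemma scl_sat_iff_wins: "scl_sat s \<phi> \<longleftrightarrow> scl_wins \<phi> [] s Plus"
  unfolding scl_sat_def ex_winning_strategy_iff_wins
  using wins_scl_game[of s \<phi> "\<lambda>_. 0"] by (simp add: scl_game_def)

lemma scl_wins_unfold:
  "scl_wins \<phi> p r sg \<longleftrightarrow> scl_step \<phi> (wins (scl_game (\<lambda>_. 0) \<phi>)) p r sg"
  by (subst wins_unfold) (rule game_step_scl)

lemma scl_wins_least:
  assumes "\<And>p r sg. scl_step \<phi> S p r sg \<Longrightarrow> S (p, r, sg)" and "scl_wins \<phi> p r sg"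
  shows "S (p, r, sg)"
  by (rule wins_least[OF _ assms(2)]) (metis assms(1) game_step_scl prod_cases3)

section \<open>Definability of winning by a universal second-order formula\<close>

primrec num_tm :: "nat \<Rightarrow> tm" where
  "num_tm 0 = Zero"
| "num_tm (Suc n) = Add (num_tm n) One"

lemma tm_val_num [simp]: "tm_val s (num_tm n) = n"
  by (induction n) auto

lemma tm_fv_num [simp]: "tm_fv (num_tm n) = {}"
  by (induction n) auto

primrec fo_foralls :: "nat \<Rightarrow> fo \<Rightarrow> fo" where
  "fo_foralls 0 \<phi> = \<phi>"
| "fo_foralls (Suc n) \<phi> = fo_foralls n (FForall n \<phi>)"

lemma fo_sat_foralls:
  "fo_sat I r (fo_foralls n \<phi>) \<longleftrightarrow> (\<forall>r'. (\<forall>i\<ge>n. r' i = r i) \<longrightarrow> fo_sat I r' \<phi>)"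
proof (induction n arbitrary: \<phi>)
  case 0
  have "(\<forall>i. r' i = r i) \<longleftrightarrow> r' = r" for r' by auto
  then show ?case by simp
next
  case (Suc n)
  have "(\<forall>r'. (\<forall>i\<ge>n. r' i = r i) \<longrightarrow> (\<forall>a. fo_sat I (r'(n := a)) \<phi>)) \<longleftrightarrow>
    (\<forall>r'. (\<forall>i\<ge>Suc n. r' i = r i) \<longrightarrow> fo_sat I r' \<phi>)" (is "?A \<longleftrightarrow> ?B")
  proof
    assume A: ?A
    show ?B
    proof (intro allI impI)
      fix r' assume "\<forall>i\<ge>Suc n. r' i = r i"
      then have "\<forall>i\<ge>n. (r'(n := r n)) i = r i" by (auto simp: Suc_le_eq)
      with A have "fo_sat I ((r'(n := r n))(n := r' n)) \<phi>" by blast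
      then show "fo_sat I r' \<phi>" by simp
    qed
  qed auto
  then show ?case by (simp add: Suc)
qed

lemma fo_foralls_simps [simp]:
  "fo_fv (fo_foralls n \<phi>) = fo_fv \<phi> - {..<n}"
  "fo_rvars (fo_foralls n \<phi>) = fo_rvars \<phi>"
  "fo_wf (fo_foralls n \<phi>) = fo_wf \<phi>"
  by (induction n arbitrary: \<phi>) (auto simp: less_Suc_eq)

primrec fo_conjs :: "fo list \<Rightarrow> fo" where
  "fo_conjs [] = FNeg (FAtom Bot)"
| "fo_conjs (\<phi> # \<phi>s) = FConj \<phi> (fo_conjs \<phi>s)"

lemma fo_conjs_simps [simp]:
  "fo_sat I r (fo_conjs \<phi>s) \<longleftrightarrow> (\<forall>\<phi>\<in>set \<phi>s. fo_sat I r \<phi>)"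
  "fo_fv (fo_conjs \<phi>s) = (\<Union>\<phi>\<in>set \<phi>s. fo_fv \<phi>)"
  "fo_rvars (fo_conjs \<phi>s) = (\<Union>\<phi>\<in>set \<phi>s. fo_rvars \<phi>)"
  "fo_wf (fo_conjs \<phi>s) \<longleftrightarrow> (\<forall>\<phi>\<in>set \<phi>s. fo_wf \<phi>)"
  by (induction \<phi>s) auto

text \<open>Bound variables count as well, since their values persist when a claim jumps
  back.\<close>

primrec scl_vars :: "scl \<Rightarrow> nat set" where
  "scl_vars (Atom a) = atom_fv a"
| "scl_vars (Neg \<phi>) = scl_vars \<phi>"
| "scl_vars (Conj \<phi> \<psi>) = scl_vars \<phi> \<union> scl_vars \<psi>"
| "scl_vars (Disj \<phi> \<psi>) = scl_vars \<phi> \<union> scl_vars \<psi>"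
| "scl_vars (Forall x \<phi>) = insert x (scl_vars \<phi>)"
| "scl_vars (Exists x \<phi>) = insert x (scl_vars \<phi>)"
| "scl_vars (Label L \<phi>) = scl_vars \<phi>"
| "scl_vars (Claim L) = {}"

lemma finite_tm_fv [simp]: "finite (tm_fv t)"
  by (induction t) auto

lemma finite_atom_fv [simp]: "finite (atom_fv a)"
  by (cases a) auto

lemma finite_scl_vars: "finite (scl_vars \<phi>)"
  by (induction \<phi>) auto

lemma finite_nat_set_bounded:
  assumes "finite (A :: nat set)"
  obtains n where "k \<le> n" "A \<subseteq> {..<n}"
proof -
  from assms obtain m where "A \<subseteq> {..<m}" using finite_nat_set_iff_bounded by auto
  then show ?thesis by (intro that[of "max k m"]) auto
qed

lemma scl_vars_subformula_at: "subformula_at \<phi> p = Some \<psi> \<Longrightarrow> scl_vars \<psi> \<subseteq> scl_vars \<phi>"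
proof (induction \<phi> p rule: subformula_at.induct)
  case (2 \<phi> i p)
  have "scl_vars (children \<phi> ! i) \<subseteq> scl_vars \<phi>" if "i < length (children \<phi>)"
    using that by (cases \<phi>) (auto simp: less_Suc_eq nth_Cons')
  with 2 show ?case by (auto split: if_splits)
qed auto

lemma finite_addresses: "finite {p. subformula_at \<phi> p \<noteq> None}"
proof (induction \<phi>)
  have *: "{p. subformula_at \<phi> p \<noteq> None} =
      insert [] (\<Union>i<length (children \<phi>). (#) i ` {p. subformula_at (children \<phi> ! i) p \<noteq> None})"
    for \<phi>
    by (auto simp: image_iff split: if_splits elim: subformula_at.elims)
  { case Atom show ?case by (subst *) simp }
  { case Neg then show ?case by (subst *) simp }
  { case Conj then show ?case by (subst *) (simp add: lessThan_Suc) }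
  { case Disj then show ?case by (subst *) (simp add: lessThan_Suc) }
  { case Forall then show ?case by (subst *) simp }
  { case Exists then show ?case by (subst *) simp }
  { case Label then show ?case by (subst *) simp }
  { case Claim show ?case by (subst *) simp }
qed

text \<open>These codes enter formulas only as numerals, so any injection will do.\<close>

definition pos_code :: "addr \<Rightarrow> sign \<Rightarrow> nat" where
  "pos_code p sg = to_nat (p, sg = Plus)"

lemma pos_code_inject [simp]: "pos_code p sg = pos_code p' sg' \<longleftrightarrow> p = p' \<and> sg = sg'"
  by (cases sg; cases sg') (auto simp: pos_code_def)

text \<open>A position is represented by its code followed by the values of the first \<open>N\<close> variables.\<close>

definition pos_rvar :: "nat \<Rightarrow> rvar" where
  "pos_rvar N = RVar 0 (Suc N)"

lemma arity_pos_rvar: "arity (pos_rvar N) = Suc N"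
  by (simp add: pos_rvar_def)

text \<open>At the start position, \<open>T\<close> puts 0 for the variables from \<open>k\<close>
  on, which keeps the free variables of the sentence below \<open>k\<close>; elsewhere it is
  \<open>Var\<close>.\<close>

definition pos_fo :: "nat \<Rightarrow> addr \<Rightarrow> sign \<Rightarrow> (nat \<Rightarrow> tm) \<Rightarrow> fo" where
  "pos_fo N p sg T = FRel (pos_rvar N) (num_tm (pos_code p sg) # map T [0..<N])"

lemma pos_fo_simps [simp]:
  "fo_sat I r (pos_fo N p sg T) \<longleftrightarrow>
    pos_code p sg # map (\<lambda>i. tm_val r (T i)) [0..<N] \<in> I (pos_rvar N)"
  "fo_fv (pos_fo N p sg T) = (\<Union>i<N. tm_fv (T i))"
  "fo_rvars (pos_fo N p sg T) = {pos_rvar N}"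
  "fo_wf (pos_fo N p sg T)"
  by (auto simp: pos_fo_def pos_rvar_def comp_def)

lemma fo_sat_pos_fo_Var [simp]:
  "fo_sat I r (pos_fo N p sg Var) \<longleftrightarrow> pos_code p sg # map r [0..<N] \<in> I (pos_rvar N)"
  by simp

text \<open>Quantifying \<open>x\<close> in front of a position atom expresses the move to
  \<open>r(x := a)\<close>, as the atom lists all values. Reference formulas depend on the syntax
  alone, so claims are resolved while the formula is built.\<close>

definition step_fo :: "scl \<Rightarrow> nat \<Rightarrow> addr \<Rightarrow> sign \<Rightarrow> fo" where
  "step_fo \<phi> N p sg =
    (let A = \<lambda>p sg. pos_fo N p sg Var in
     case subformula_at \<phi> p of
       None \<Rightarrow> FAtom Bot
     | Some (Atom a) \<Rightarrow> if sg = Plus then FAtom a else FNeg (FAtom a)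
     | Some (Neg \<psi>) \<Rightarrow> A (p @ [0]) (flip sg)
     | Some (Conj \<psi> \<chi>) \<Rightarrow>
         (if sg = Plus then FConj else FDisj) (A (p @ [0]) sg) (A (p @ [1]) sg)
     | Some (Disj \<psi> \<chi>) \<Rightarrow>
         (if sg = Plus then FDisj else FConj) (A (p @ [0]) sg) (A (p @ [1]) sg)
     | Some (Forall x \<psi>) \<Rightarrow> (if sg = Plus then FForall else FExists) x (A (p @ [0]) sg)
     | Some (Exists x \<psi>) \<Rightarrow> (if sg = Plus then FExists else FForall) x (A (p @ [0]) sg)
     | Some (Label L \<psi>) \<Rightarrow> A (p @ [0]) sg
     | Some (Claim L) \<Rightarrow>
         if \<exists>q. reference \<phi> L p q then A (THE q. reference \<phi> L p q) sg else FAtom Bot)"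

lemma step_fo_wf: "fo_wf (step_fo \<phi> N p sg)" "fo_rvars (step_fo \<phi> N p sg) \<subseteq> {pos_rvar N}"
  by (auto simp: step_fo_def Let_def split: option.split scl.split)

lemma step_fo_fv:
  assumes "scl_vars \<phi> \<subseteq> {..<N}"
  shows "fo_fv (step_fo \<phi> N p sg) \<subseteq> {..<N}"
proof (cases "subformula_at \<phi> p")
  case (Some \<psi>)
  then have "scl_vars \<psi> \<subseteq> {..<N}" using scl_vars_subformula_at assms by blast
  with Some show ?thesis by (cases \<psi>) (auto simp: step_fo_def Let_def)
qed (simp add: step_fo_def)

text \<open>Moves change only variables below \<open>N\<close>, so assignments that agree with
  \<open>s\<close> from \<open>N\<close> on form a class closed under moves; its members are
  determined by their first \<open>N\<close> values.\<close>

lemma fo_sat_step_fo: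
  assumes S: "\<And>p' r' sg'. \<forall>i\<ge>N. r' i = s i \<Longrightarrow>
      S (p', r', sg') \<longleftrightarrow> pos_code p' sg' # map r' [0..<N] \<in> I (pos_rvar N)"
    and r: "\<forall>i\<ge>N. r i = s i" and N: "scl_vars \<phi> \<subseteq> {..<N}"
  shows "fo_sat I r (step_fo \<phi> N p sg) \<longleftrightarrow> scl_step \<phi> S p r sg"
proof (cases "subformula_at \<phi> p")
  case (Some \<psi>)
  then have "scl_vars \<psi> \<subseteq> {..<N}" using scl_vars_subformula_at N by blast
  moreover have "(THE q. reference \<phi> L p q) = q" if "reference \<phi> L p q" for L q
    using that reference_unique by blast
  ultimately show ?thesis using Some r
    by (cases \<psi>; cases sg) (auto simp: step_fo_def scl_step_def Let_def S simp del: pos_fo_simps(1))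
qed (simp add: step_fo_def scl_step_def)

definition pos_list :: "scl \<Rightarrow> (addr \<times> sign) list" where
  "pos_list \<phi> = (SOME ps. set ps = {p. subformula_at \<phi> p \<noteq> None} \<times> UNIV)"

lemma set_pos_list: "set (pos_list \<phi>) = {p. subformula_at \<phi> p \<noteq> None} \<times> UNIV"
proof -
  have "UNIV = {Plus, Minus}" using sign.exhaust by blast
  then have "finite (UNIV :: sign set)" by (metis finite.simps)
  then have "\<exists>ps. set ps = {p. subformula_at \<phi> p \<noteq> None} \<times> (UNIV :: sign set)"
    using finite_addresses by (intro finite_list finite_SigmaI) auto
  then show ?thesis unfolding pos_list_def by (rule someI_ex)
qed

definition closed_fo :: "scl \<Rightarrow> nat \<Rightarrow> fo" where
  "closed_fo \<phi> N = fo_foralls N (fo_conjs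
    (map (\<lambda>(p, sg). FDisj (FNeg (step_fo \<phi> N p sg)) (pos_fo N p sg Var)) (pos_list \<phi>)))"

definition win_uso :: "scl \<Rightarrow> nat \<Rightarrow> nat \<Rightarrow> uso" where
  "win_uso \<phi> k N = ForallRel (pos_rvar N) (Matrix
    (FDisj (FNeg (closed_fo \<phi> N)) (pos_fo N [] Plus (\<lambda>i. if i < k then Var i else Zero))))"

lemma fo_sat_closed_fo:
  assumes "\<And>p' r' sg'. \<forall>i\<ge>N. r' i = s i \<Longrightarrow>
      S (p', r', sg') \<longleftrightarrow> pos_code p' sg' # map r' [0..<N] \<in> I (pos_rvar N)"
    and "scl_vars \<phi> \<subseteq> {..<N}"
  shows "fo_sat I s (closed_fo \<phi> N) \<longleftrightarrow>
    (\<forall>p r sg. (\<forall>i\<ge>N. r i = s i) \<longrightarrow> scl_step \<phi> S p r sg \<longrightarrow> S (p, r, sg))"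
proof -
  have "subformula_at \<phi> p \<noteq> None" if "scl_step \<phi> S p r sg" for p r sg
    using that by (auto simp: scl_step_def split: option.splits)
  moreover have "fo_sat I s (closed_fo \<phi> N) \<longleftrightarrow> (\<forall>r. (\<forall>i\<ge>N. r i = s i) \<longrightarrow>
      (\<forall>p sg. subformula_at \<phi> p \<noteq> None \<longrightarrow> scl_step \<phi> S p r sg \<longrightarrow> S (p, r, sg)))"
    using fo_sat_step_fo[of N s S I, OF assms(1) _ assms(2)] assms(1)
    by (auto simp: closed_fo_def fo_sat_foralls set_pos_list simp del: pos_fo_simps(1))
  ultimately show ?thesis by blast
qed

lemma uso_sat_win_uso:
  assumes "scl_vars \<phi> \<subseteq> {..<N}" "length m = k" "k \<le> N"
  shows "uso_sat I (tuple_asg m) (win_uso \<phi> k N) \<longleftrightarrow> scl_sat (tuple_asg m) \<phi>"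
proof -
  define s where "s = tuple_asg m"
  have "map (\<lambda>i. tm_val s (if i < k then Var i else Zero)) [0..<N] = map s [0..<N]"
    using assms by (auto simp: s_def tuple_asg_def)
  then have start: "fo_sat J s (pos_fo N [] Plus (\<lambda>i. if i < k then Var i else Zero)) \<longleftrightarrow>
      pos_code [] Plus # map s [0..<N] \<in> J (pos_rvar N)" for J
    by (simp only: pos_fo_simps)
  let ?I = "\<lambda>R. I(pos_rvar N := R)"
  have "(\<forall>R\<subseteq>{v. length v = Suc N}. fo_sat (?I R) s (closed_fo \<phi> N) \<longrightarrow>
      pos_code [] Plus # map s [0..<N] \<in> R) \<longleftrightarrow> scl_wins \<phi> [] s Plus" (is "?A \<longleftrightarrow> ?B")
  proof
    assume A: ?A
    \<comment> \<open>The hypothesis is applied to the true winning positions, which are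
      closed.\<close>
    define R where "R = {pos_code p sg # map r [0..<N] | p sg r.
      (\<forall>i\<ge>N. r i = s i) \<and> scl_wins \<phi> p r sg}"
    have R: "wins (scl_game (\<lambda>_. 0) \<phi>) (p, r, sg) \<longleftrightarrow>
        pos_code p sg # map r [0..<N] \<in> ?I R (pos_rvar N)" if "\<forall>i\<ge>N. r i = s i" for p r sg
    proof -
      have ext: "r' = r" if "\<forall>i\<ge>N. r' i = s i" "map r' [0..<N] = map r [0..<N]" for r'
        using that \<open>\<forall>i\<ge>N. r i = s i\<close> by (intro ext) (metis atLeastLessThan_iff map_eq_conv
            not_le set_upt zero_le)
      then have "scl_wins \<phi> p r sg" if "pos_code p sg # map r [0..<N] \<in> R"
      proof -
        from that obtain p' sg' r' where "pos_code p sg # map r [0..<N] = pos_code p' sg' # map r' [0..<N]"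
          "\<forall>i\<ge>N. r' i = s i" "scl_wins \<phi> p' r' sg'"
          unfolding R_def by blast
        with ext show ?thesis by simp
      qed
      then show ?thesis using that by (auto simp: R_def)
    qed
    have "R \<subseteq> {v. length v = Suc N}" by (auto simp: R_def)
    moreover have "fo_sat (?I R) s (closed_fo \<phi> N)"
      using fo_sat_closed_fo[of N s "wins (scl_game (\<lambda>_. 0) \<phi>)" "?I R", OF R assms(1)] scl_wins_unfold
      by blast
    ultimately show ?B using A R by auto
  next
    assume B: ?B
    show ?A
    proof (intro allI impI)
      fix R assume cl: "fo_sat (?I R) s (closed_fo \<phi> N)"
      define S where "S = (\<lambda>(p, r, sg). (\<forall>i\<ge>N. r i = s i) \<longrightarrow> pos_code p sg # map r [0..<N] \<in> R)"
      have "S (p, r, sg) \<longleftrightarrow> pos_code p sg # map r [0..<N] \<in> ?I R (pos_rvar N)"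
        if "\<forall>i\<ge>N. r i = s i" for p r sg
        using that by (simp add: S_def)
      from fo_sat_closed_fo[of N s S "?I R", OF this assms(1)] cl
      have "\<forall>p r sg. (\<forall>i\<ge>N. r i = s i) \<longrightarrow> scl_step \<phi> S p r sg \<longrightarrow> S (p, r, sg)"
        by blast
      then have "S (p, r, sg)" if "scl_step \<phi> S p r sg" for p r sg
        using that unfolding S_def by blast
      from scl_wins_least[of \<phi> S, OF this B] show "pos_code [] Plus # map s [0..<N] \<in> R"
        by (auto simp: S_def)
    qed
  qed
  then show ?thesis
    by (simp add: win_uso_def scl_sat_iff_wins start arity_pos_rvar s_def[symmetric]
        del: pos_fo_simps(1))
qed

theorem SCL_definable_imp_Pi11_relation:
  assumes "SCL_definable k X"
  shows "Pi11_relation k X"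
proof -
  from assms obtain \<phi> where \<phi>: "\<And>m. length m = k \<Longrightarrow> m \<in> X \<longleftrightarrow> scl_sat (tuple_asg m) \<phi>"
    by (auto simp: SCL_definable_def)
  obtain N where N: "k \<le> N" "scl_vars \<phi> \<subseteq> {..<N}"
    using finite_nat_set_bounded finite_scl_vars by metis
  have "uso_wf (win_uso \<phi> k N)" "uso_free_rvars (win_uso \<phi> k N) = {}"
    using step_fo_wf by (fastforce simp: win_uso_def closed_fo_def)+
  moreover have "uso_fv (win_uso \<phi> k N) \<subseteq> {..<k}"
    using step_fo_fv[OF N(2)] by (fastforce simp: win_uso_def closed_fo_def split: if_splits)
  ultimately show ?thesis
    unfolding Pi11_relation_def using \<phi> uso_sat_win_uso[OF N(2) _ N(1)] by blast
qed

section \<open>Refuting sequences of truth values and witnesses\<close>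

lemma tm_val_cong: "(\<And>x. x \<in> tm_fv t \<Longrightarrow> s x = s' x) \<Longrightarrow> tm_val s t = tm_val s' t"
  by (induction t) auto

lemma atom_sat_cong: "(\<And>x. x \<in> atom_fv a \<Longrightarrow> s x = s' x) \<Longrightarrow> atom_sat s a = atom_sat s' a"
  using tm_val_cong[of _ s s'] by (cases a) simp_all

text \<open>Well-formed atoms ask only about tuples of the right length; this allows relations to be
  cut down to their arity.\<close>

lemma fo_sat_cong:
  assumes "fo_wf \<phi>" "\<And>x. x \<in> fo_fv \<phi> \<Longrightarrow> s x = s' x"
    and "\<And>X v. X \<in> fo_rvars \<phi> \<Longrightarrow> length v = arity X \<Longrightarrow> v \<in> I X \<longleftrightarrow> v \<in> J X"
  shows "fo_sat I s \<phi> \<longleftrightarrow> fo_sat J s' \<phi>"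
  using assms
proof (induction \<phi> arbitrary: s s')
  case (FAtom a)
  then show ?case using atom_sat_cong[of a s s'] by simp
next
  case (FRel X ts)
  then have eq: "map (tm_val s) ts = map (tm_val s') ts" by (auto intro: tm_val_cong)
  show ?case
    unfolding fo_sat.simps eq by (rule FRel.prems(3)) (use FRel.prems(1) in simp_all)
next
  case (FForall x \<phi>)
  then have "fo_sat I (s(x := a)) \<phi> = fo_sat J (s'(x := a)) \<phi>" for a
    by (intro FForall.IH) auto
  then show ?case by simp
next
  case (FExists x \<phi>)
  then have "fo_sat I (s(x := a)) \<phi> = fo_sat J (s'(x := a)) \<phi>" for a
    by (intro FExists.IH) auto
  then show ?case by simp
next
  case (FNeg \<phi>)
  then have "fo_sat I s \<phi> = fo_sat J s' \<phi>" by (intro FNeg.IH) auto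
  then show ?case by simp
next
  case (FConj \<phi> \<chi>)
  then have "fo_sat I s \<phi> = fo_sat J s' \<phi>" "fo_sat I s \<chi> = fo_sat J s' \<chi>"
    by (intro FConj.IH; auto)+
  then show ?case by simp
next
  case (FDisj \<phi> \<chi>)
  then have "fo_sat I s \<phi> = fo_sat J s' \<phi>" "fo_sat I s \<chi> = fo_sat J s' \<chi>"
    by (intro FDisj.IH; auto)+
  then show ?case by simp
qed

section \<open>Collapsing the second-order prefix\<close>

primrec uso_matrix :: "uso \<Rightarrow> fo" where
  "uso_matrix (Matrix \<psi>) = \<psi>"
| "uso_matrix (ForallRel X \<Phi>) = uso_matrix \<Phi>"

primrec uso_bound_rvars :: "uso \<Rightarrow> rvar set" where
  "uso_bound_rvars (Matrix \<psi>) = {}"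
| "uso_bound_rvars (ForallRel X \<Phi>) = insert X (uso_bound_rvars \<Phi>)"

lemma uso_matrix_simps:
  "uso_wf \<Phi> \<longleftrightarrow> fo_wf (uso_matrix \<Phi>)"
  "uso_fv \<Phi> = fo_fv (uso_matrix \<Phi>)"
  "uso_free_rvars \<Phi> = fo_rvars (uso_matrix \<Phi>) - uso_bound_rvars \<Phi>"
  by (induction \<Phi>) auto

lemma uso_sat_iff:
  "uso_sat I s \<Phi> \<longleftrightarrow> (\<forall>J. (\<forall>X. X \<notin> uso_bound_rvars \<Phi> \<longrightarrow> J X = I X) \<longrightarrow>
     (\<forall>X\<in>uso_bound_rvars \<Phi>. J X \<subseteq> {v. length v = arity X}) \<longrightarrow> fo_sat J s (uso_matrix \<Phi>))"
proof (induction \<Phi> arbitrary: I)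
  case (Matrix \<psi>)
  have "(\<forall>X. J X = I X) \<longleftrightarrow> J = I" for J :: rel_asg by auto
  then show ?case by simp
next
  case (ForallRel Y \<Phi>)
  let ?ok = "\<lambda>I J. (\<forall>X. X \<notin> uso_bound_rvars \<Phi> \<longrightarrow> J X = I X) \<and>
     (\<forall>X\<in>uso_bound_rvars \<Phi>. J X \<subseteq> {v. length v = arity X})"
  let ?ok' = "\<lambda>J. (\<forall>X. X \<notin> uso_bound_rvars (ForallRel Y \<Phi>) \<longrightarrow> J X = I X) \<and>
     (\<forall>X\<in>uso_bound_rvars (ForallRel Y \<Phi>). J X \<subseteq> {v. length v = arity X})"
  have eq: "?ok' J \<longleftrightarrow> (\<exists>R \<subseteq> {v. length v = arity Y}. ?ok (I(Y := R)) J)" for J :: rel_asg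
  proof
    assume "?ok' J"
    then show "\<exists>R \<subseteq> {v. length v = arity Y}. ?ok (I(Y := R)) J"
      \<comment> \<open>If \<open>Y\<close> is bound again further in, the inner choice overwrites
        the outer one; \<open>J Y\<close> is admissible in either case.\<close>
      by (intro exI[of _ "J Y"]) auto
  next
    assume "\<exists>R \<subseteq> {v. length v = arity Y}. ?ok (I(Y := R)) J"
    then show "?ok' J" by (cases "Y \<in> uso_bound_rvars \<Phi>") (auto split: if_splits)
  qed
  have "uso_sat I s (ForallRel Y \<Phi>) \<longleftrightarrow> (\<forall>J. ?ok' J \<longrightarrow> fo_sat J s (uso_matrix \<Phi>))"
    unfolding eq uso_sat.simps ForallRel by blast
  then show ?case by (simp only: uso_matrix.simps imp_conjL)
qed

text \<open>Cutting \<open>J\<close> down to tuples of the right length does not affect a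
  well-formed matrix, and all its relation variables are bound.\<close>

lemma uso_sat_closed_iff:
  assumes "uso_wf \<Phi>" "uso_free_rvars \<Phi> = {}"
  shows "uso_sat I s \<Phi> \<longleftrightarrow> (\<forall>J. fo_sat J s (uso_matrix \<Phi>))"
proof
  assume sat: "uso_sat I s \<Phi>"
  show "\<forall>J. fo_sat J s (uso_matrix \<Phi>)"
  proof
    fix J
    let ?J = "\<lambda>X. if X \<in> uso_bound_rvars \<Phi> then J X \<inter> {v. length v = arity X} else I X"
    have "fo_sat ?J s (uso_matrix \<Phi>)"
      by (rule iffD1[OF uso_sat_iff sat, rule_format]) auto
    moreover have "fo_sat ?J s (uso_matrix \<Phi>) \<longleftrightarrow> fo_sat J s (uso_matrix \<Phi>)"
      by (rule fo_sat_cong) (use assms in \<open>auto simp: uso_matrix_simps\<close>)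
    ultimately show "fo_sat J s (uso_matrix \<Phi>)" by simp
  qed
qed (simp add: uso_sat_iff)

text \<open>A false universal formula becomes a true existential one, whose entry can record a
  counterexample.\<close>

primrec fo_core :: "fo \<Rightarrow> fo" where
  "fo_core (FAtom a) = FAtom a"
| "fo_core (FRel X ts) = FRel X ts"
| "fo_core (FNeg \<phi>) = FNeg (fo_core \<phi>)"
| "fo_core (FConj \<phi> \<psi>) = FConj (fo_core \<phi>) (fo_core \<psi>)"
| "fo_core (FDisj \<phi> \<psi>) = FNeg (FConj (FNeg (fo_core \<phi>)) (FNeg (fo_core \<psi>)))"
| "fo_core (FForall x \<phi>) = FNeg (FExists x (FNeg (fo_core \<phi>)))"
| "fo_core (FExists x \<phi>) = FExists x (fo_core \<phi>)"

primrec is_core :: "fo \<Rightarrow> bool" where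
  "is_core (FAtom a) \<longleftrightarrow> True"
| "is_core (FRel X ts) \<longleftrightarrow> True"
| "is_core (FNeg \<phi>) \<longleftrightarrow> is_core \<phi>"
| "is_core (FConj \<phi> \<psi>) \<longleftrightarrow> is_core \<phi> \<and> is_core \<psi>"
| "is_core (FDisj \<phi> \<psi>) \<longleftrightarrow> False"
| "is_core (FForall x \<phi>) \<longleftrightarrow> False"
| "is_core (FExists x \<phi>) \<longleftrightarrow> is_core \<phi>"

lemma fo_core_simps [simp]:
  "is_core (fo_core \<phi>)"
  "fo_sat I s (fo_core \<phi>) \<longleftrightarrow> fo_sat I s \<phi>"
  "fo_fv (fo_core \<phi>) = fo_fv \<phi>"
  "fo_wf (fo_core \<phi>) \<longleftrightarrow> fo_wf \<phi>"
  by (induction \<phi> arbitrary: s) auto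

primrec fo_vars :: "fo \<Rightarrow> nat set" where
  "fo_vars (FAtom a) = atom_fv a"
| "fo_vars (FRel X ts) = (\<Union>t\<in>set ts. tm_fv t)"
| "fo_vars (FNeg \<phi>) = fo_vars \<phi>"
| "fo_vars (FConj \<phi> \<psi>) = fo_vars \<phi> \<union> fo_vars \<psi>"
| "fo_vars (FDisj \<phi> \<psi>) = fo_vars \<phi> \<union> fo_vars \<psi>"
| "fo_vars (FForall x \<phi>) = insert x (fo_vars \<phi>)"
| "fo_vars (FExists x \<phi>) = insert x (fo_vars \<phi>)"

lemma fo_fv_subset_vars: "fo_fv \<phi> \<subseteq> fo_vars \<phi>"
  by (induction \<phi>) auto

section \<open>Coding formulas and tuples by numbers\<close>

instance tm :: countable by countable_datatype
instance atom :: countable by countable_datatype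
instance rvar :: countable by countable_datatype
instance fo :: countable by countable_datatype

text \<open>A polynomial with natural coefficients, so that a term of arithmetic computes it;
  Cantor's pairing would need a halving.\<close>

definition pair_code :: "nat \<Rightarrow> nat \<Rightarrow> nat" where
  "pair_code x y = (x + y) * (x + y) + x"

text \<open>With \<open>s = x + y\<close>, the value lies between \<open>s * s\<close> and
  \<open>s * s + s\<close>, below the square of \<open>s + 1\<close>; so it determines
  \<open>s\<close>, and then \<open>x\<close>.\<close>

lemma pair_code_inject [simp]: "pair_code x y = pair_code x' y' \<longleftrightarrow> x = x' \<and> y = y'"
proof
  have less: "pair_code x y < pair_code x' y'" if "x + y < x' + y'" for x y x' y'
  proof -
    have "pair_code x y < Suc (x + y) * Suc (x + y)" by (simp add: pair_code_def)
    also have "\<dots> \<le> (x' + y') * (x' + y')" using that by (intro mult_mono) auto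
    also have "\<dots> \<le> pair_code x' y'" by (simp add: pair_code_def)
    finally show ?thesis .
  qed
  assume eq: "pair_code x y = pair_code x' y'"
  have "x + y = x' + y'"
    using less[of x y x' y'] less[of x' y' x y] eq by linarith
  with eq show "x = x' \<and> y = y'" by (simp add: pair_code_def)
qed simp

primrec list_code :: "nat list \<Rightarrow> nat" where
  "list_code [] = 0"
| "list_code (v # vs) = pair_code v (list_code vs)"

text \<open>Equal length matters: \<open>[]\<close> and \<open>[0]\<close> have the same
  code.\<close>

lemma list_code_inject: "length vs = length ws \<Longrightarrow> list_code vs = list_code ws \<longleftrightarrow> vs = ws"
  by (induction vs ws rule: list_induct2) auto

definition index_code :: "fo + rvar \<Rightarrow> nat list \<Rightarrow> nat" where
  "index_code c vs = pair_code (to_nat c) (list_code vs)"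

abbreviation fo_index :: "nat \<Rightarrow> fo \<Rightarrow> asg \<Rightarrow> nat" where
  "fo_index N \<phi> r \<equiv> index_code (Inl \<phi>) (map r [0..<N])"

lemma fo_index_cong: "(\<And>i. i < N \<Longrightarrow> r i = r' i) \<Longrightarrow> fo_index N \<phi> r = fo_index N \<phi> r'"
  by (metis (no_types, lifting) atLeastLessThan_iff map_cong set_upt)

text \<open>\<open>K i z\<close> says that the entry \<open>i\<close> of a sequence is known to be \<open>z\<close>. The entry at
  \<open>fo_index N \<phi> r\<close> encodes the truth value of \<open>\<phi>\<close> under \<open>r\<close> (zero for false), and for a true
  existential formula it is the successor of a witness; the entries at \<open>index_code (Inr X)\<close> form the
  characteristic function of \<open>X\<close>. A clash is a local inconsistency of known entries with this
  reading. The cases of disjunctions and universal quantifiers are irrelevant, as these are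
  eliminated by \<open>fo_core\<close>.\<close>

primrec clash :: "nat \<Rightarrow> (nat \<Rightarrow> nat \<Rightarrow> bool) \<Rightarrow> fo \<Rightarrow> asg \<Rightarrow> bool" where
  "clash N K (FAtom a) r \<longleftrightarrow> (\<exists>z. K (fo_index N (FAtom a) r) z \<and> (z = 0 \<longleftrightarrow> atom_sat r a))"
| "clash N K (FRel X ts) r \<longleftrightarrow> (\<exists>z z1. K (fo_index N (FRel X ts) r) z \<and>
     K (index_code (Inr X) (map (tm_val r) ts)) z1 \<and> (z = 0 \<longleftrightarrow> z1 \<noteq> 0))"
| "clash N K (FNeg \<phi>) r \<longleftrightarrow> (\<exists>z z1. K (fo_index N (FNeg \<phi>) r) z \<and>
     K (fo_index N \<phi> r) z1 \<and> (z = 0 \<longleftrightarrow> z1 = 0)) \<or> clash N K \<phi> r"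
| "clash N K (FConj \<phi> \<psi>) r \<longleftrightarrow> (\<exists>z z1 z2. K (fo_index N (FConj \<phi> \<psi>) r) z \<and>
     K (fo_index N \<phi> r) z1 \<and> K (fo_index N \<psi> r) z2 \<and> (z = 0 \<longleftrightarrow> z1 \<noteq> 0 \<and> z2 \<noteq> 0)) \<or>
     clash N K \<phi> r \<or> clash N K \<psi> r"
| "clash N K (FDisj \<phi> \<psi>) r \<longleftrightarrow> False"
| "clash N K (FForall x \<phi>) r \<longleftrightarrow> False"
| "clash N K (FExists x \<phi>) r \<longleftrightarrow> (\<exists>w z z1. K (fo_index N (FExists x \<phi>) r) z \<and>
     K (fo_index N \<phi> (r(x := w))) z1 \<and> (z = Suc w \<and> z1 = 0 \<or> z = 0 \<and> z1 \<noteq> 0)) \<or>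
     clash N K \<phi> r"

text \<open>\<open>K\<close> occurs only positively in \<open>clash\<close>.\<close>

lemma clash_mono:
  assumes "\<And>i z. K i z \<Longrightarrow> K' i z"
  shows "clash N K \<phi> r \<Longrightarrow> clash N K' \<phi> r"
  by (induction \<phi>)
    (simp only: clash.simps, (elim disj_forward ex_forward conj_forward)?; (erule assms | assumption)?)+

text \<open>A clash reads at most three entries; the successor of the sum of their indices is a
  bound. This is why Eloise can win at a finite stage.\<close>

lemma clash_finite:
  assumes "clash N (\<lambda>i z. f i = z) \<phi> r"
  shows "\<exists>n. clash N (\<lambda>i z. i < n \<and> f i = z) \<phi> r"
  using assms
proof (induction \<phi>)
  case (FAtom a)
  then show ?case by auto
next
  case (FRel X ts)
  then show ?case
    by (intro exI[of _ "Suc (fo_index N (FRel X ts) r + index_code (Inr X) (map (tm_val r) ts))"]) auto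
next
  case (FNeg \<phi>)
  then show ?case
  proof (cases "clash N (\<lambda>i z. f i = z) \<phi> r")
    case False
    with FNeg show ?thesis
      by (intro exI[of _ "Suc (fo_index N (FNeg \<phi>) r + fo_index N \<phi> r)"]) auto
  qed auto
next
  case (FConj \<phi> \<psi>)
  then show ?case
  proof (cases "clash N (\<lambda>i z. f i = z) \<phi> r \<or> clash N (\<lambda>i z. f i = z) \<psi> r")
    case False
    with FConj show ?thesis
      by (intro exI[of _ "Suc (fo_index N (FConj \<phi> \<psi>) r + fo_index N \<phi> r + fo_index N \<psi> r)"]) auto
  qed auto
next
  case (FExists x \<phi>)
  then show ?case
  proof (cases "clash N (\<lambda>i z. f i = z) \<phi> r")
    case False
    with FExists obtain w where w:
      "f (fo_index N (FExists x \<phi>) r) = Suc w \<and> f (fo_index N \<phi> (r(x := w))) = 0 \<or>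
       f (fo_index N (FExists x \<phi>) r) = 0 \<and> f (fo_index N \<phi> (r(x := w))) \<noteq> 0"
      by auto
    let ?n = "Suc (fo_index N (FExists x \<phi>) r + fo_index N \<phi> (r(x := w)))"
    have "clash N (\<lambda>i z. i < ?n \<and> f i = z) (FExists x \<phi>) r"
      unfolding clash.simps
      by (rule disjI1, intro exI[of _ w] exI conjI; (rule refl)?) (use w in auto)
    then show ?thesis by blast
  qed auto
qed auto

text \<open>Absence of clashes amounts to Tarski's truth definition for the relations stored in
  \<open>f\<close>.\<close>

lemma no_clash_sat:
  assumes "\<And>r. \<not> clash N (\<lambda>i z. f i = z) \<phi> r" "is_core \<phi>"
  shows "f (fo_index N \<phi> r) \<noteq> 0 \<longleftrightarrow> fo_sat (\<lambda>X. {u. f (index_code (Inr X) u) \<noteq> 0}) r \<phi>"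
  using assms
proof (induction \<phi> arbitrary: r)
  case (FExists x \<phi>)
  then have IH: "f (fo_index N \<phi> r) \<noteq> 0 \<longleftrightarrow> fo_sat (\<lambda>X. {u. f (index_code (Inr X) u) \<noteq> 0}) r \<phi>" for r
    by simp
  let ?j = "fo_index N (FExists x \<phi>) r"
  have nc: "\<not> (f ?j = Suc w \<and> f (fo_index N \<phi> (r(x := w))) = 0)"
    "\<not> (f ?j = 0 \<and> f (fo_index N \<phi> (r(x := w))) \<noteq> 0)" for w
    using FExists.prems(1)[of r] by auto
  \<comment> \<open>A nonzero entry is \<open>Suc w\<close> for a witness \<open>w\<close>; a zero
    entry rules out every witness.\<close>
  have "f ?j \<noteq> 0 \<longleftrightarrow> (\<exists>w. f (fo_index N \<phi> (r(x := w))) \<noteq> 0)"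
    using nc by (metis not0_implies_Suc)
  then show ?case using IH by simp
next
  case (FAtom a)
  from FAtom.prems(1)[of r] show ?case by auto
next
  case (FRel X ts)
  from FRel.prems(1)[of r] show ?case by auto
next
  case (FNeg \<phi>)
  then have "f (fo_index N \<phi> r) \<noteq> 0 \<longleftrightarrow> fo_sat (\<lambda>X. {u. f (index_code (Inr X) u) \<noteq> 0}) r \<phi>"
    by simp
  with FNeg.prems(1)[of r] show ?case by auto
next
  case (FConj \<phi> \<psi>)
  then have "f (fo_index N \<phi> r) \<noteq> 0 \<longleftrightarrow> fo_sat (\<lambda>X. {u. f (index_code (Inr X) u) \<noteq> 0}) r \<phi>"
    "f (fo_index N \<psi> r) \<noteq> 0 \<longleftrightarrow> fo_sat (\<lambda>X. {u. f (index_code (Inr X) u) \<noteq> 0}) r \<psi>"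
    by simp_all
  with FConj.prems(1)[of r] show ?case by auto
qed simp_all

text \<open>The sequence records truth under \<open>I\<close>, with least witnesses for existential
  formulas.\<close>

lemma clash_free_valuation:
  assumes "fo_wf \<psi>" "is_core \<psi>" "fo_vars \<psi> \<subseteq> {..<N}" "\<not> fo_sat I s \<psi>"
  obtains f where "\<And>r. \<not> clash N (\<lambda>i z. f i = z) \<psi> r" "f (fo_index N \<psi> s) = 0"
proof -
  define g where "g c u = (case c of
      Inr X \<Rightarrow> if u \<in> I X then 1 else 0
    | Inl (FExists x \<phi>) \<Rightarrow> if \<exists>w. fo_sat I ((tuple_asg u)(x := w)) \<phi>
        then Suc (LEAST w. fo_sat I ((tuple_asg u)(x := w)) \<phi>) else 0
    | Inl \<phi> \<Rightarrow> if fo_sat I (tuple_asg u) \<phi> then 1 else (0 :: nat))" for c :: "fo + rvar" and u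
  \<comment> \<open>On \<open>D\<close> the first component fixes the length of the list, which
    makes \<open>index_code\<close> injective there.\<close>
  define D :: "((fo + rvar) \<times> nat list) set" where "D = {(c, u). length u = (case c of Inl \<phi> \<Rightarrow> N | Inr X \<Rightarrow> arity X)}"
  define f where "f j = case_prod g (inv_into D (case_prod index_code) j)" for j
  have "inj_on (case_prod index_code) D"
    by (rule inj_onI) (auto simp: D_def index_code_def list_code_inject split: sum.splits)
  then have f: "f (index_code c u) = g c u" if "(c, u) \<in> D" for c u
    using that inv_into_f_f[of "case_prod index_code" D "(c, u)"] by (simp add: f_def)
  have fX: "f (index_code (Inr X) u) = g (Inr X) u" if "length u = arity X" for X u
    using that by (intro f) (auto simp: D_def)
  have fI: "f (fo_index N \<phi> r) = g (Inl \<phi>) (map r [0..<N])" for \<phi> r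
    by (intro f) (auto simp: D_def)
  have restrict: "fo_sat I ((tuple_asg (map r [0..<N]))(x := w)) \<phi> \<longleftrightarrow> fo_sat I (r(x := w)) \<phi>"
    if "fo_wf \<phi>" "fo_vars \<phi> \<subseteq> {..<N}" for \<phi> r x w
    using fo_fv_subset_vars[of \<phi>] that by (intro fo_sat_cong) (auto simp: tuple_asg_def)
  have restrict': "fo_sat I (tuple_asg (map r [0..<N])) \<phi> \<longleftrightarrow> fo_sat I r \<phi>"
    if "fo_wf \<phi>" "fo_vars \<phi> \<subseteq> {..<N}" for \<phi> r
    using fo_fv_subset_vars[of \<phi>] that by (intro fo_sat_cong) (auto simp: tuple_asg_def)
  have fE: "f (fo_index N (FExists x \<phi>) r) = (if \<exists>w. fo_sat I (r(x := w)) \<phi>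
        then Suc (LEAST w. fo_sat I (r(x := w)) \<phi>) else 0)"
    if "fo_wf \<phi>" "fo_vars \<phi> \<subseteq> {..<N}" for x \<phi> r
    using that by (simp add: fI g_def restrict)
  have truth: "f (fo_index N \<phi> r) = 0 \<longleftrightarrow> \<not> fo_sat I r \<phi>"
    if "fo_wf \<phi>" "fo_vars \<phi> \<subseteq> {..<N}" for \<phi> r
  proof (cases "\<exists>x \<chi>. \<phi> = FExists x \<chi>")
    case True
    then show ?thesis using that fE by auto
  next
    case False
    then have "f (fo_index N \<phi> r) = (if fo_sat I (tuple_asg (map r [0..<N])) \<phi> then 1 else 0)"
      by (cases \<phi>) (simp_all add: fI g_def)
    with that show ?thesis by (simp add: restrict')
  qed
  have "\<not> clash N (\<lambda>i z. f i = z) \<phi> r" if "fo_wf \<phi>" "fo_vars \<phi> \<subseteq> {..<N}" "is_core \<phi>" for \<phi> r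
    using that
  proof (induction \<phi>)
    case (FAtom a)
    then show ?case using truth[of "FAtom a"] by simp
  next
    case (FRel X ts)
    then show ?case using truth[of "FRel X ts"] by (simp add: fX g_def)
  next
    case (FNeg \<phi>)
    then show ?case using truth[of "FNeg \<phi>"] truth[of \<phi>] by simp
  next
    case (FConj \<phi> \<chi>)
    then show ?case using truth[of "FConj \<phi> \<chi>"] truth[of \<phi>] truth[of \<chi>] by auto
  next
    case (FExists x \<phi>)
    then have wf: "fo_wf \<phi>" "fo_vars \<phi> \<subseteq> {..<N}" by auto
    have "\<not> (f (fo_index N (FExists x \<phi>) r) = Suc w \<and> f (fo_index N \<phi> (r(x := w))) = 0)" for w
      using LeastI_ex[of "\<lambda>w. fo_sat I (r(x := w)) \<phi>"] by (auto simp: fE[OF wf] truth[OF wf])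
    moreover have "\<not> (f (fo_index N (FExists x \<phi>) r) = 0 \<and> f (fo_index N \<phi> (r(x := w))) \<noteq> 0)" for w
      by (auto simp: fE[OF wf] truth[OF wf])
    ultimately show ?case using FExists by auto
  qed auto
  with that truth assms show thesis by blast
qed

text \<open>All relations are traded for one sequence of numbers. Either disjunct, when true, shows
  in a finite initial segment of \<open>f\<close>, so the game can test it.\<close>

theorem all_interpretations_iff_clash:
  assumes "fo_wf \<psi>" "is_core \<psi>" "fo_vars \<psi> \<subseteq> {..<N}"
  shows "(\<forall>I. fo_sat I s \<psi>) \<longleftrightarrow>
    (\<forall>f. (\<exists>r. clash N (\<lambda>i z. f i = z) \<psi> r) \<or> f (fo_index N \<psi> s) \<noteq> 0)"
proof
  assume "\<forall>I. fo_sat I s \<psi>"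
  then show "\<forall>f. (\<exists>r. clash N (\<lambda>i z. f i = z) \<psi> r) \<or> f (fo_index N \<psi> s) \<noteq> 0"
    using no_clash_sat[OF _ assms(2)] by blast
next
  assume "\<forall>f. (\<exists>r. clash N (\<lambda>i z. f i = z) \<psi> r) \<or> f (fo_index N \<psi> s) \<noteq> 0"
  then show "\<forall>I. fo_sat I s \<psi>" using clash_free_valuation[OF assms] by metis
qed

section \<open>Goedel's beta function\<close>

definition beta :: "nat \<Rightarrow> nat \<Rightarrow> nat \<Rightarrow> nat" where
  "beta a b i = a mod (1 + (i + 1) * b)"

text \<open>Chinese remaindering. A common divisor of two moduli is coprime to \<open>b\<close>,
  hence divides \<open>j - i\<close>, hence \<open>b\<close>, hence is 1.\<close>

lemma beta_sequence: "\<exists>a b. \<forall>i<n. beta a b i = f i"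
proof -
  \<comment> \<open>The summand \<open>n\<close> makes each difference \<open>j - i\<close> divide
    \<open>fact B\<close>; the sum keeps each \<open>f i\<close> below its modulus.\<close>
  define B where "B = n + (\<Sum>i<n. f i)"
  define b :: nat where "b = fact B"
  have le: "f i \<le> b" if "i < n" for i
  proof -
    have "f i \<le> (\<Sum>i<n. f i)" using that by (intro member_le_sum) auto
    also have "\<dots> \<le> fact B" using fact_ge_self[of B] by (simp add: B_def)
    finally show ?thesis by (simp add: b_def)
  qed
  have "coprime (1 + (i + 1) * b) (1 + (j + 1) * b)" if "i < j" "j < n" for i j
  proof (rule coprimeI)
    fix d assume d: "d dvd 1 + (i + 1) * b" "d dvd 1 + (j + 1) * b"
    have unit: "e dvd 1" if "e dvd d" "e dvd b" for e
      using d(1) that by (metis dvd_add_left_iff dvd_mult dvd_trans)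
    then have "coprime d b" by (intro coprimeI)
    moreover have "d dvd (1 + (j + 1) * b) - (1 + (i + 1) * b)" using d by (rule dvd_diff_nat[rotated])
    moreover have "(1 + (j + 1) * b) - (1 + (i + 1) * b) = (j - i) * b"
      by (simp add: diff_mult_distrib)
    ultimately have "d dvd j - i" by (simp add: coprime_dvd_mult_left_iff)
    moreover have "j - i dvd b" using that by (auto simp: b_def B_def intro!: dvd_fact)
    ultimately have "d dvd b" by (rule dvd_trans)
    with unit[of d] show "d dvd 1" by simp
  qed
  then have "\<forall>i\<in>{..<n}. \<forall>j\<in>{..<n}. i \<noteq> j \<longrightarrow> coprime (1 + (i + 1) * b) (1 + (j + 1) * b)"
    by (metis coprime_commute lessThan_iff linorder_neqE_nat)
  from chinese_remainder_nat[OF _ this, of f]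
  obtain a where a: "\<And>i. i < n \<Longrightarrow> [a = f i] (mod (1 + (i + 1) * b))" by auto
  have "beta a b i = f i" if "i < n" for i
    using a[OF that] le[OF that] by (simp add: beta_def cong_def)
  then show ?thesis by blast
qed

section \<open>First-order description of refutations\<close>

definition pair_tm :: "tm \<Rightarrow> tm \<Rightarrow> tm" where
  "pair_tm t u = Add (Mult (Add t u) (Add t u)) t"

primrec list_tm :: "tm list \<Rightarrow> tm" where
  "list_tm [] = Zero"
| "list_tm (t # ts) = pair_tm t (list_tm ts)"

definition index_tm :: "fo + rvar \<Rightarrow> tm list \<Rightarrow> tm" where
  "index_tm c ts = pair_tm (num_tm (to_nat c)) (list_tm ts)"

lemma index_tm_simps [simp]:
  "tm_val r (index_tm c ts) = index_code c (map (tm_val r) ts)"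
  "tm_fv (index_tm c ts) = (\<Union>t\<in>set ts. tm_fv t)"
proof -
  have "tm_val r (list_tm ts) = list_code (map (tm_val r) ts)"
    by (induction ts) (simp_all add: pair_tm_def pair_code_def)
  then show "tm_val r (index_tm c ts) = index_code c (map (tm_val r) ts)"
    by (simp add: index_tm_def index_code_def pair_tm_def pair_code_def)
  have "tm_fv (list_tm ts) = (\<Union>t\<in>set ts. tm_fv t)"
    by (induction ts) (auto simp: pair_tm_def)
  then show "tm_fv (index_tm c ts) = (\<Union>t\<in>set ts. tm_fv t)"
    by (simp add: index_tm_def pair_tm_def)
qed

lemma tm_val_fun_upd [simp]: "x \<notin> tm_fv t \<Longrightarrow> tm_val (s(x := a)) t = tm_val s t"
  by (rule tm_val_cong) auto

text \<open>The bound variable \<open>q\<close> is the quotient in the division defining \<open>beta\<close>.\<close>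

definition beta_fo :: "nat \<Rightarrow> tm \<Rightarrow> tm \<Rightarrow> tm \<Rightarrow> tm \<Rightarrow> fo" where
  "beta_fo q a b i z = (let m = Add One (Mult (Add i One) b) in
    FExists q (FConj (FAtom (Equal a (Add (Mult (Var q) m) z))) (FAtom (Less z m))))"

lemma fo_sat_beta_fo [simp]:
  assumes "q \<notin> tm_fv a" "q \<notin> tm_fv b" "q \<notin> tm_fv i" "q \<notin> tm_fv z"
  shows "fo_sat I r (beta_fo q a b i z) \<longleftrightarrow>
    beta (tm_val r a) (tm_val r b) (tm_val r i) = tm_val r z"
proof -
  have "(\<exists>q. x = q * m + y \<and> y < m) \<longleftrightarrow> x mod m = y" if "m > 0" for x y m :: nat
    using that by (metis add.commute div_mult_mod_eq mod_less mod_less_divisor mod_mult_self1)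
  from this[of "1 + (tm_val r i + 1) * tm_val r b" "tm_val r a" "tm_val r z"] show ?thesis
    using assms by (simp add: beta_fo_def beta_def Let_def)
qed

lemma fo_fv_beta_fo [simp]:
  "fo_fv (beta_fo q a b i z) = (tm_fv a \<union> tm_fv b \<union> tm_fv i \<union> tm_fv z) - {q}"
  by (auto simp: beta_fo_def Let_def)

lemma fo_rvars_beta_fo [simp]: "fo_rvars (beta_fo q a b i z) = {}"
  by (simp add: beta_fo_def Let_def)

text \<open>The variables below \<open>N\<close> are those of the given formula. Variables \<open>N\<close>, \<open>N + 1\<close>, \<open>N + 2\<close>
  hold the current state \<open>(a, b, c)\<close> in which the entries \<open>beta a b i\<close> with \<open>i < c\<close> are revealed,
  \<open>N + 3\<close> holds the index of the formula under the initial assignment,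
  \<open>N + 4\<close>, \<open>N + 5\<close>, \<open>N + 6\<close> hold the previous state, and the others are auxiliary.\<close>

definition known :: "nat \<Rightarrow> asg \<Rightarrow> nat \<Rightarrow> nat \<Rightarrow> bool" where
  "known N r i z \<longleftrightarrow> i < r (N + 2) \<and> beta (r N) (r (N + 1)) i = z"

definition known_fo :: "nat \<Rightarrow> tm \<Rightarrow> tm \<Rightarrow> fo" where
  "known_fo N t z =
    FConj (FAtom (Less t (Var (N + 2)))) (beta_fo (N + 11) (Var N) (Var (N + 1)) t z)"

lemma fo_sat_known_fo [simp]:
  assumes "N + 11 \<notin> tm_fv t" "N + 11 \<notin> tm_fv z"
  shows "fo_sat I r (known_fo N t z) \<longleftrightarrow> known N r (tm_val r t) (tm_val r z)"
  using assms by (simp add: known_fo_def known_def)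

lemma fo_fv_known_fo:
  "fo_fv (known_fo N t z) \<subseteq> tm_fv t \<union> tm_fv z \<union> {N, N + 1, N + 2}"
  by (auto simp: known_fo_def)

lemma fo_rvars_known_fo [simp]: "fo_rvars (known_fo N t z) = {}"
  by (simp add: known_fo_def)

text \<open>\<open>N + 7\<close> carries a candidate witness, which the index terms may mention;
  \<open>N + 8\<close> to \<open>N + 10\<close> carry the entries read. Conditions on fewer entries
  repeat the index \<open>t\<close>.\<close>

definition local_clash_fo :: "nat \<Rightarrow> tm \<Rightarrow> tm \<Rightarrow> tm \<Rightarrow> fo \<Rightarrow> fo" where
  "local_clash_fo N t t1 t2 \<theta> =
    FExists (N + 7) (FExists (N + 8) (FExists (N + 9) (FExists (N + 10)
      (FConj (known_fo N t (Var (N + 8))) (FConj (known_fo N t1 (Var (N + 9)))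
        (FConj (known_fo N t2 (Var (N + 10))) \<theta>))))))"

lemma fo_sat_local_clash_fo:
  assumes "tm_fv t \<subseteq> {..N + 7}" "tm_fv t1 \<subseteq> {..N + 7}" "tm_fv t2 \<subseteq> {..N + 7}"
  shows "fo_sat I r (local_clash_fo N t t1 t2 \<theta>) \<longleftrightarrow> (\<exists>w z z1 z2.
    known N r (tm_val (r(N + 7 := w)) t) z \<and> known N r (tm_val (r(N + 7 := w)) t1) z1 \<and>
    known N r (tm_val (r(N + 7 := w)) t2) z2 \<and>
    fo_sat I (r(N + 7 := w, N + 8 := z, N + 9 := z1, N + 10 := z2)) \<theta>)"
proof -
  have notin: "N + k \<notin> tm_fv u" if "tm_fv u \<subseteq> {..N + 7}" "7 < k" for u k
    using that by auto
  have "known N (r(N + 7 := w, N + 8 := z, N + 9 := z1, N + 10 := z2)) = known N r" for w z z1 z2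
    by (intro ext) (simp add: known_def)
  then show ?thesis
    using notin[OF assms(1)] notin[OF assms(2)] notin[OF assms(3)]
    by (simp add: local_clash_fo_def)
qed

abbreviation fo_index_tm :: "nat \<Rightarrow> fo \<Rightarrow> (nat \<Rightarrow> tm) \<Rightarrow> tm" where
  "fo_index_tm N \<phi> T \<equiv> index_tm (Inl \<phi>) (map T [0..<N])"

definition zero_fo :: "nat \<Rightarrow> fo" where
  "zero_fo x = FAtom (Equal (Var x) Zero)"

definition iff_fo :: "fo \<Rightarrow> fo \<Rightarrow> fo" where
  "iff_fo \<phi> \<psi> = FDisj (FConj \<phi> \<psi>) (FConj (FNeg \<phi>) (FNeg \<psi>))"

lemma zero_iff_fo_simps [simp]:
  "fo_sat I r (zero_fo x) \<longleftrightarrow> r x = 0" "fo_fv (zero_fo x) = {x}" "fo_rvars (zero_fo x) = {}"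
  "fo_sat I r (iff_fo \<phi> \<psi>) \<longleftrightarrow> (fo_sat I r \<phi> \<longleftrightarrow> fo_sat I r \<psi>)"
  "fo_fv (iff_fo \<phi> \<psi>) = fo_fv \<phi> \<union> fo_fv \<psi>" "fo_rvars (iff_fo \<phi> \<psi>) = fo_rvars \<phi> \<union> fo_rvars \<psi>"
  by (auto simp: zero_fo_def iff_fo_def)

text \<open>The update of \<open>r\<close> at \<open>x\<close> takes place inside the index term,
  where the candidate witness in \<open>N + 7\<close> replaces \<open>x\<close>.\<close>

primrec clash_fo :: "nat \<Rightarrow> fo \<Rightarrow> fo" where
  "clash_fo N (FAtom a) =
    (let t = fo_index_tm N (FAtom a) Var in
     local_clash_fo N t t t (iff_fo (zero_fo (N + 8)) (FAtom a)))"
| "clash_fo N (FRel X ts) =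
    (let t = fo_index_tm N (FRel X ts) Var in
     local_clash_fo N t (index_tm (Inr X) ts) t
       (iff_fo (zero_fo (N + 8)) (FNeg (zero_fo (N + 9)))))"
| "clash_fo N (FNeg \<phi>) =
    (let t = fo_index_tm N (FNeg \<phi>) Var in
     FDisj (local_clash_fo N t (fo_index_tm N \<phi> Var) t (iff_fo (zero_fo (N + 8)) (zero_fo (N + 9))))
       (clash_fo N \<phi>))"
| "clash_fo N (FConj \<phi> \<psi>) =
    FDisj (local_clash_fo N (fo_index_tm N (FConj \<phi> \<psi>) Var)
        (fo_index_tm N \<phi> Var) (fo_index_tm N \<psi> Var)
        (iff_fo (zero_fo (N + 8)) (FConj (FNeg (zero_fo (N + 9))) (FNeg (zero_fo (N + 10))))))
      (FDisj (clash_fo N \<phi>) (clash_fo N \<psi>))"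
| "clash_fo N (FDisj \<phi> \<psi>) = FAtom Bot"
| "clash_fo N (FForall x \<phi>) = FAtom Bot"
| "clash_fo N (FExists x \<phi>) =
    (let t = fo_index_tm N (FExists x \<phi>) Var in
     FDisj (local_clash_fo N t (fo_index_tm N \<phi> (Var(x := Var (N + 7)))) t
        (FDisj (FConj (FAtom (Equal (Var (N + 8)) (Add (Var (N + 7)) One))) (zero_fo (N + 9)))
          (FConj (zero_fo (N + 8)) (FNeg (zero_fo (N + 9))))))
      (clash_fo N \<phi>))"

lemma known_functional: "known N r i z \<Longrightarrow> known N r i z' \<Longrightarrow> z = z'"
  by (simp add: known_def)

lemma fo_sat_clash_fo:
  assumes "fo_vars \<phi> \<subseteq> {..<N}"
  shows "fo_sat I r (clash_fo N \<phi>) \<longleftrightarrow> clash N (known N r) \<phi> r"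
  using assms
proof (induction \<phi>)
  have var: "tm_fv (fo_index_tm N \<phi> Var) \<subseteq> {..N + 7}" for \<phi> by auto
  have val: "tm_val (r(N + 7 := w)) (fo_index_tm N \<phi> Var) = fo_index N \<phi> r" for w \<phi>
    by (simp add: comp_def) (rule fo_index_cong, simp)
  {
    case (FAtom a)
    then have "N + k \<notin> atom_fv a" for k by auto
    then have "atom_sat (r(N + 7 := w, N + 8 := z, N + 9 := z1, N + 10 := z2)) a = atom_sat r a" for w z z1 z2
      by (intro atom_sat_cong) auto
    then show ?case
      by (auto simp: Let_def fo_sat_local_clash_fo var val simp del: index_tm_simps dest: known_functional)
  next
    case (FRel X ts)
    have fv: "tm_fv (index_tm (Inr X) ts) \<subseteq> {..N + 7}" using FRel by fastforce
    have "N + 7 \<notin> tm_fv t" if "t \<in> set ts" for t using FRel that by fastforce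
    then have val': "tm_val (r(N + 7 := w)) (index_tm (Inr X) ts) = index_code (Inr X) (map (tm_val r) ts)" for w
      by (simp cong: map_cong)
    show ?case
      by (auto simp: Let_def fo_sat_local_clash_fo var val fv val' simp del: index_tm_simps dest: known_functional)
  next
    case (FNeg \<phi>)
    then show ?case
      by (auto simp: Let_def fo_sat_local_clash_fo var val simp del: index_tm_simps dest: known_functional)
  next
    case (FConj \<phi> \<psi>)
    then show ?case
      by (auto simp: Let_def fo_sat_local_clash_fo var val simp del: index_tm_simps dest: known_functional)
  next
    case (FDisj \<phi> \<psi>)
    show ?case by simp
  next
    case (FForall x \<phi>)
    show ?case by simp
  next
    case (FExists x \<phi>)
    have fv: "tm_fv (fo_index_tm N \<phi> (Var(x := Var (N + 7)))) \<subseteq> {..N + 7}" by (auto split: if_splits)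
    have val': "tm_val (r(N + 7 := w)) (fo_index_tm N \<phi> (Var(x := Var (N + 7)))) =
        fo_index N \<phi> (r(x := w))" for w
      by (simp add: comp_def) (rule fo_index_cong, simp)
    from FExists show ?case
      by (auto simp: Let_def fo_sat_local_clash_fo var val fv val' simp del: index_tm_simps dest: known_functional)
  }
qed

lemma fo_rvars_clash_fo: "fo_rvars (clash_fo N \<phi>) = {}"
  by (induction \<phi>) (simp_all add: local_clash_fo_def Let_def)

lemma fo_fv_local_clash_fo:
  "fo_fv (local_clash_fo N t t1 t2 \<theta>) \<subseteq>
    {N, N + 1, N + 2} \<union> (tm_fv t \<union> tm_fv t1 \<union> tm_fv t2 \<union> fo_fv \<theta>) - {N + 7, N + 8, N + 9, N + 10}"
  using fo_fv_known_fo[of N t] fo_fv_known_fo[of N t1] fo_fv_known_fo[of N t2]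
  by (fastforce simp: local_clash_fo_def)

lemma fo_fv_clash_fo:
  assumes "fo_vars \<phi> \<subseteq> {..<N}"
  shows "fo_fv (clash_fo N \<phi>) \<subseteq> {..N + 2}"
  using assms
proof (induction \<phi>)
  case (FRel X ts)
  then have "x \<le> N + 2" if "t \<in> set ts" "x \<in> tm_fv t" for x t
    using that by fastforce
  then show ?case
    by (auto simp: Let_def dest!: subsetD[OF fo_fv_local_clash_fo])
next
  case (FExists x \<phi>)
  then show ?case
    by (auto simp: Let_def dest!: subsetD[OF fo_fv_local_clash_fo] split: if_splits)
qed (auto simp: Let_def dest!: subsetD[OF fo_fv_local_clash_fo])

definition refuted_fo :: "nat \<Rightarrow> fo \<Rightarrow> fo" where
  "refuted_fo N \<phi> = FDisj (FNeg (fo_foralls N (FNeg (clash_fo N \<phi>))))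
    (FExists (N + 8) (FConj (known_fo N (Var (N + 3)) (Var (N + 8))) (FNeg (zero_fo (N + 8)))))"

lemma fo_sat_refuted_fo:
  assumes "fo_vars \<phi> \<subseteq> {..<N}"
  shows "fo_sat I r (refuted_fo N \<phi>) \<longleftrightarrow>
    (\<exists>r'. clash N (known N r) \<phi> r') \<or> (\<exists>z. known N r (r (N + 3)) z \<and> z \<noteq> 0)"
proof -
  have cong: "clash N K \<phi> r = clash N K \<phi> r'" if "\<And>i. i < N \<Longrightarrow> r i = r' i" for K r r'
    using assms
  proof (induction \<phi>)
    have idx: "fo_index N \<phi> r = fo_index N \<phi> r'" for \<phi>
      using that by (rule fo_index_cong)
    {
      case (FAtom a)
      then have "atom_sat r a = atom_sat r' a" using that by (intro atom_sat_cong) auto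
      with idx show ?case by simp
    next
      case (FRel X ts)
      then have "map (tm_val r) ts = map (tm_val r') ts" using that by (auto intro!: tm_val_cong)
      with idx show ?case by (simp only: clash.simps)
    next
      case (FExists x \<phi>)
      have "fo_index N \<phi> (r(x := w)) = fo_index N \<phi> (r'(x := w))" for w
        using that by (intro fo_index_cong) simp
      with FExists idx show ?case by simp
    }
  qed (use fo_index_cong[OF that] in simp_all)
  have "(\<exists>r'. (\<forall>i\<ge>N. r' i = r i) \<and> clash N (known N r') \<phi> r') \<longleftrightarrow> (\<exists>r'. clash N (known N r) \<phi> r')"
  proof
    assume "\<exists>r'. (\<forall>i\<ge>N. r' i = r i) \<and> clash N (known N r') \<phi> r'"
    then obtain r' where r': "\<forall>i\<ge>N. r' i = r i" "clash N (known N r') \<phi> r'" by blast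
    then have "known N r' = known N r" by (intro ext) (simp add: known_def)
    with r' show "\<exists>r'. clash N (known N r) \<phi> r'" by auto
  next
    assume "\<exists>r'. clash N (known N r) \<phi> r'"
    then obtain r' where r': "clash N (known N r) \<phi> r'" by blast
    \<comment> \<open>\<open>clash\<close> looks at \<open>r'\<close> only below \<open>N\<close>
      and \<open>known\<close> looks at \<open>r\<close> only from \<open>N\<close> on, so the two
      can be merged.\<close>
    let ?r = "\<lambda>i. if i < N then r' i else r i"
    have "known N ?r = known N r" by (intro ext) (simp add: known_def)
    moreover have "clash N (known N r) \<phi> ?r" using r' cong[of ?r r'] by simp
    ultimately show "\<exists>r'. (\<forall>i\<ge>N. r' i = r i) \<and> clash N (known N r') \<phi> r'"
      by (intro exI[of _ ?r]) simp
  qed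
  moreover have "known N (r(N + 8 := z)) = known N r" for z
    by (intro ext) (simp add: known_def)
  ultimately show ?thesis
    by (auto simp: refuted_fo_def fo_sat_foralls fo_sat_clash_fo[OF assms])
qed

lemma refuted_fo_simps:
  "fo_rvars (refuted_fo N \<phi>) = {}"
  "fo_vars \<phi> \<subseteq> {..<N} \<Longrightarrow> fo_fv (refuted_fo N \<phi>) \<subseteq> {N..N + 3}"
  using fo_fv_clash_fo[of \<phi> N] fo_fv_known_fo[of N "Var (N + 3)" "Var (N + 8)"]
  by (auto simp: refuted_fo_def fo_rvars_clash_fo)

text \<open>Old and new parameters are unrelated as numbers, so the decoded entries are compared one
  by one.\<close>

definition agree_fo :: "nat \<Rightarrow> fo" where
  "agree_fo N = FForall (N + 7) (FDisj (FNeg (FAtom (Less (Var (N + 7)) (Var (N + 6)))))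
    (FExists (N + 8) (FConj (beta_fo (N + 11) (Var N) (Var (N + 1)) (Var (N + 7)) (Var (N + 8)))
      (beta_fo (N + 11) (Var (N + 4)) (Var (N + 5)) (Var (N + 7)) (Var (N + 8))))))"

lemma agree_fo_simps:
  "fo_sat I r (agree_fo N) \<longleftrightarrow>
    (\<forall>i<r (N + 6). beta (r N) (r (N + 1)) i = beta (r (N + 4)) (r (N + 5)) i)"
  "fo_fv (agree_fo N) = {N, N + 1, N + 4, N + 5, N + 6}"
  "fo_rvars (agree_fo N) = {}"
  by (auto simp: agree_fo_def)

section \<open>The refutation game\<close>

text \<open>Compositional evaluation of a formula all of whose claims have the same reference formula;
  \<open>Z\<close> tells for which assignments and signs Eloise wins from there.\<close>

primrec scl_eval :: "(asg \<Rightarrow> sign \<Rightarrow> bool) \<Rightarrow> scl \<Rightarrow> asg \<Rightarrow> sign \<Rightarrow> bool" where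
  "scl_eval Z (Atom a) r sg \<longleftrightarrow> (sg = Plus) = atom_sat r a"
| "scl_eval Z (Neg \<phi>) r sg \<longleftrightarrow> scl_eval Z \<phi> r (flip sg)"
| "scl_eval Z (Conj \<phi> \<psi>) r sg \<longleftrightarrow>
    (if sg = Plus then scl_eval Z \<phi> r sg \<and> scl_eval Z \<psi> r sg
     else scl_eval Z \<phi> r sg \<or> scl_eval Z \<psi> r sg)"
| "scl_eval Z (Disj \<phi> \<psi>) r sg \<longleftrightarrow>
    (if sg = Plus then scl_eval Z \<phi> r sg \<or> scl_eval Z \<psi> r sg
     else scl_eval Z \<phi> r sg \<and> scl_eval Z \<psi> r sg)"
| "scl_eval Z (Forall x \<phi>) r sg \<longleftrightarrow>
    (if sg = Plus then \<forall>a. scl_eval Z \<phi> (r(x := a)) sg else \<exists>a. scl_eval Z \<phi> (r(x := a)) sg)"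
| "scl_eval Z (Exists x \<phi>) r sg \<longleftrightarrow>
    (if sg = Plus then \<exists>a. scl_eval Z \<phi> (r(x := a)) sg else \<forall>a. scl_eval Z \<phi> (r(x := a)) sg)"
| "scl_eval Z (Label L \<phi>) r sg \<longleftrightarrow> scl_eval Z \<phi> r sg"
| "scl_eval Z (Claim L) r sg \<longleftrightarrow> Z r sg"

definition claims_refer :: "scl \<Rightarrow> addr \<Rightarrow> addr \<Rightarrow> bool" where
  "claims_refer \<phi> p q0 \<longleftrightarrow>
    (\<forall>q L. subformula_at \<phi> (p @ q) = Some (Claim L) \<longrightarrow> reference \<phi> L (p @ q) q0)"

lemma claims_refer_append: "claims_refer \<phi> p q0 \<Longrightarrow> claims_refer \<phi> (p @ q) q0"
  by (simp add: claims_refer_def)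

lemma claims_refer_Claim:
  assumes "claims_refer \<phi> p q0" "subformula_at \<phi> p = Some (Claim L)"
  shows "reference \<phi> L p q \<longleftrightarrow> q = q0"
  using assms reference_unique[of \<phi> L p] by (auto simp: claims_refer_def dest: spec[of _ "[]"])

text \<open>Below \<open>p\<close> every claim leads to \<open>q0\<close>, so the fixed point need
  only be unfolded along the finite syntax tree.\<close>

lemma scl_wins_eval:
  assumes "subformula_at \<phi> p = Some \<chi>" "claims_refer \<phi> p q0"
  shows "scl_wins \<phi> p r sg \<longleftrightarrow> scl_eval (scl_wins \<phi> q0) \<chi> r sg"
  using assms
proof (induction \<chi> arbitrary: p r sg)
  case (Claim L)
  with claims_refer_Claim[OF Claim(2,1)] show ?case
    by (subst scl_wins_unfold) (simp add: scl_step_def)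
qed (subst scl_wins_unfold, simp add: scl_step_def subformula_at_append claims_refer_append)+

text \<open>The induction principle for the loop: \<open>Z\<close> has to be checked for one round
  only.\<close>

lemma scl_wins_loop_least:
  assumes sub: "subformula_at \<phi> q0 = Some \<chi>" and refer: "claims_refer \<phi> q0 q0"
    and closed: "\<And>r sg. scl_eval Z \<chi> r sg \<Longrightarrow> Z r sg" and wins: "scl_wins \<phi> q0 r sg"
  shows "Z r sg"
proof -
  \<comment> \<open>Outside the loop body \<open>K\<close> holds trivially; inside, it is evaluation
    with claims read as \<open>Z\<close>. At \<open>q0\<close>, \<open>closed\<close> turns this
    evaluation into \<open>Z\<close>, which settles the claims.\<close>
  define K where "K = (\<lambda>(p, r, sg). \<forall>q \<chi>'. p = q0 @ q \<longrightarrow> subformula_at \<phi> p = Some \<chi>' \<longrightarrow>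
    scl_eval Z \<chi>' r sg)"
  have "K (p, r, sg)" if step: "scl_step \<phi> K p r sg" for p r sg
    unfolding K_def
  proof (clarify)
    fix q \<chi>' assume p: "p = q0 @ q" and \<chi>': "subformula_at \<phi> (q0 @ q) = Some \<chi>'"
    have K: "scl_eval Z \<eta> r' sg'" if "K (p @ q', r', sg')" "subformula_at \<chi>' q' = Some \<eta>" for q' \<eta> r' sg'
    proof -
      have "subformula_at \<phi> ((q0 @ q) @ q') = Some \<eta>"
        using \<chi>' that(2) by (subst subformula_at_append) simp
      with that(1) p show ?thesis by (auto simp: K_def)
    qed
    have K0: "Z r' sg'" if "K (q0, r', sg')" for r' sg'
      using that sub closed by (auto simp: K_def)
    show "scl_eval Z \<chi>' r sg"
    proof (cases \<chi>')
      case (Claim L)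
      with claims_refer_Claim[OF claims_refer_append[OF refer]] \<chi>' step p K0 show ?thesis
        by (auto simp: scl_step_def)
    qed (use step p \<chi>' K[of "[0]"] K[of "[1]"] in \<open>auto simp: scl_step_def split: if_splits\<close>)
  qed
  from scl_wins_least[of \<phi> K, OF this wins] sub closed show ?thesis by (auto simp: K_def)
qed

text \<open>Only used for formulas without relation variables, hence the arbitrary value for \<open>FRel\<close>.\<close>

primrec scl_of_fo :: "fo \<Rightarrow> scl" where
  "scl_of_fo (FAtom a) = Atom a"
| "scl_of_fo (FRel X ts) = Atom Bot"
| "scl_of_fo (FNeg \<phi>) = Neg (scl_of_fo \<phi>)"
| "scl_of_fo (FConj \<phi> \<psi>) = Conj (scl_of_fo \<phi>) (scl_of_fo \<psi>)"
| "scl_of_fo (FDisj \<phi> \<psi>) = Disj (scl_of_fo \<phi>) (scl_of_fo \<psi>)"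
| "scl_of_fo (FForall x \<phi>) = Forall x (scl_of_fo \<phi>)"
| "scl_of_fo (FExists x \<phi>) = Exists x (scl_of_fo \<phi>)"

lemma scl_eval_of_fo:
  assumes "fo_rvars \<phi> = {}"
  shows "scl_eval Z (scl_of_fo \<phi>) r sg \<longleftrightarrow> (sg = Plus) = fo_sat I r \<phi>"
  using assms by (induction \<phi> arbitrary: r sg) (case_tac [!] sg, auto)

lemma scl_fv_of_fo: "fo_rvars \<phi> = {} \<Longrightarrow> scl_fv (scl_of_fo \<phi>) = fo_fv \<phi>"
  by (induction \<phi>) auto

lemma subformula_at_of_fo [simp]:
  "subformula_at (scl_of_fo \<phi>) q \<noteq> Some (Claim L)"
  "subformula_at (scl_of_fo \<phi>) q \<noteq> Some (Label L \<chi>)"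
proof (induction \<phi> arbitrary: q)
  case (FConj \<phi> \<psi>)
  { case 1 from FConj show ?case by (cases q) (auto simp: less_Suc_eq) }
  { case 2 from FConj show ?case by (cases q) (auto simp: less_Suc_eq) }
next
  case (FDisj \<phi> \<psi>)
  { case 1 from FDisj show ?case by (cases q) (auto simp: less_Suc_eq) }
  { case 2 from FDisj show ?case by (cases q) (auto simp: less_Suc_eq) }
qed (case_tac [!] q, auto)

lemma subformula_at_iff:
  "subformula_at (Conj \<phi> \<psi>) q = Some \<chi> \<longleftrightarrow> q = [] \<and> \<chi> = Conj \<phi> \<psi> \<or>
    (\<exists>q'. q = 0 # q' \<and> subformula_at \<phi> q' = Some \<chi>) \<or>
    (\<exists>q'. q = 1 # q' \<and> subformula_at \<psi> q' = Some \<chi>)"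
  "subformula_at (Disj \<phi> \<psi>) q = Some \<chi> \<longleftrightarrow> q = [] \<and> \<chi> = Disj \<phi> \<psi> \<or>
    (\<exists>q'. q = 0 # q' \<and> subformula_at \<phi> q' = Some \<chi>) \<or>
    (\<exists>q'. q = 1 # q' \<and> subformula_at \<psi> q' = Some \<chi>)"
  "subformula_at (Forall x \<phi>) q = Some \<chi> \<longleftrightarrow> q = [] \<and> \<chi> = Forall x \<phi> \<or>
    (\<exists>q'. q = 0 # q' \<and> subformula_at \<phi> q' = Some \<chi>)"
  "subformula_at (Exists x \<phi>) q = Some \<chi> \<longleftrightarrow> q = [] \<and> \<chi> = Exists x \<phi> \<or>
    (\<exists>q'. q = 0 # q' \<and> subformula_at \<phi> q' = Some \<chi>)"
  "subformula_at (Label L \<phi>) q = Some \<chi> \<longleftrightarrow> q = [] \<and> \<chi> = Label L \<phi> \<or>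
    (\<exists>q'. q = 0 # q' \<and> subformula_at \<phi> q' = Some \<chi>)"
  "subformula_at (Claim L) q = Some \<chi> \<longleftrightarrow> q = [] \<and> \<chi> = Claim L"
  by (cases q; auto simp: less_Suc_eq)+

text \<open>SCL cannot assign values: Eloise chooses the copies, and Abelard may challenge these
  equations.\<close>

definition vars_eq_fo :: "nat \<Rightarrow> fo" where
  "vars_eq_fo N = FConj (FAtom (Equal (Var (N + 4)) (Var N)))
    (FConj (FAtom (Equal (Var (N + 5)) (Var (N + 1)))) (FAtom (Equal (Var (N + 6)) (Var (N + 2)))))"

text \<open>Zero from \<open>k\<close> on matches \<open>tuple_asg\<close> and keeps the free
  variables below \<open>k\<close>.\<close>

definition start_fo :: "nat \<Rightarrow> nat \<Rightarrow> fo \<Rightarrow> fo" where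
  "start_fo k N \<psi> = FConj (FAtom (Equal (Var (N + 2)) Zero))
    (FAtom (Equal (Var (N + 3)) (fo_index_tm N \<psi> (\<lambda>i. if i < k then Var i else Zero))))"

text \<open>Eloise may stop when the revealed entries are refuted. In every round the
  state is saved, then Eloise asks for some number \<open>c\<close> of entries and Abelard answers by numbers
  \<open>a\<close>, \<open>b\<close>, which have to agree with the entries already revealed.\<close>

definition round_scl :: "nat \<Rightarrow> fo \<Rightarrow> scl" where
  "round_scl N \<psi> = Disj (scl_of_fo (refuted_fo N \<psi>))
    (Exists (N + 4) (Exists (N + 5) (Exists (N + 6) (Conj (scl_of_fo (vars_eq_fo N))
      (Exists (N + 2) (Forall N (Forall (N + 1)
        (Disj (scl_of_fo (FNeg (agree_fo N))) (Claim 0)))))))))"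

definition refutation_scl :: "nat \<Rightarrow> nat \<Rightarrow> fo \<Rightarrow> scl" where
  "refutation_scl k N \<psi> = Exists N (Exists (N + 1) (Exists (N + 2) (Exists (N + 3)
    (Conj (scl_of_fo (start_fo k N \<psi>)) (Label 0 (round_scl N \<psi>))))))"

abbreviation loop_addr :: addr where
  "loop_addr \<equiv> [0, 0, 0, 0, 1]"

lemma refutation_scl_addrs:
  "subformula_at (refutation_scl k N \<psi>) loop_addr = Some (Label 0 (round_scl N \<psi>))"
  "labelled_at (refutation_scl k N \<psi>) L q \<longleftrightarrow> L = 0 \<and> q = loop_addr"
  "subformula_at (refutation_scl k N \<psi>) q = Some (Claim L) \<longleftrightarrow>
     L = 0 \<and> q = loop_addr @ [0, 1, 0, 0, 0, 1, 0, 0, 0, 1]"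
  by (auto simp: refutation_scl_def round_scl_def labelled_at_def subformula_at_iff
      simp del: scl_of_fo.simps)

lemma claims_refer_refutation_scl: "claims_refer (refutation_scl k N \<psi>) p loop_addr"
  by (auto simp: claims_refer_def refutation_scl_addrs reference_def)

text \<open>Since Eloise may challenge a disagreement, agreement becomes a hypothesis on Abelard's
  answer.\<close>

definition reveal_step :: "nat \<Rightarrow> (asg \<Rightarrow> bool) \<Rightarrow> asg \<Rightarrow> bool" where
  "reveal_step N Z r \<longleftrightarrow> (\<exists>c. \<forall>a b. (\<forall>i<r (N + 2). beta a b i = beta (r N) (r (N + 1)) i) \<longrightarrow>
    Z (r(N + 4 := r N, N + 5 := r (N + 1), N + 6 := r (N + 2), N + 2 := c, N := a, N + 1 := b)))"

lemma scl_eval_round: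
  "scl_eval Z (round_scl N \<psi>) r Plus \<longleftrightarrow>
    fo_sat (\<lambda>_. {}) r (refuted_fo N \<psi>) \<or> reveal_step N (\<lambda>r. Z r Plus) r"
  by (simp add: round_scl_def scl_eval_of_fo[where I = "\<lambda>_. {}"] refuted_fo_simps agree_fo_simps
      vars_eq_fo_def reveal_step_def imp_conv_disj del: disj_not1 scl_of_fo.simps)

section \<open>Correctness of the refutation game\<close>

context
  fixes k N :: nat and \<psi> :: fo
  assumes wf: "fo_wf \<psi>" and core: "is_core \<psi>" and vars: "fo_vars \<psi> \<subseteq> {..<N}" and k: "k \<le> N"
begin

abbreviation "loop_wins r \<equiv> scl_wins (refutation_scl k N \<psi>) loop_addr r Plus"

lemma loop_wins_unfold:
  "loop_wins r \<longleftrightarrow> fo_sat (\<lambda>_. {}) r (refuted_fo N \<psi>) \<or> reveal_step N loop_wins r"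
  by (subst scl_wins_eval[OF refutation_scl_addrs(1) claims_refer_refutation_scl])
    (simp only: scl_eval.simps scl_eval_round)

text \<open>If Abelard always answers according to a fixed sequence without clashes, then Eloise never wins.\<close>

lemma not_loop_wins:
  assumes f: "\<And>r. \<not> clash N (\<lambda>i z. f i = z) \<psi> r" "f m = 0"
    and r: "\<And>i. i < r (N + 2) \<Longrightarrow> beta (r N) (r (N + 1)) i = f i" "r (N + 3) = m"
  shows "\<not> loop_wins r"
proof
  \<comment> \<open>The invariant kept by Abelard; its failure is closed under a round, so Eloise
    wins only where it fails.\<close>
  define inv where "inv r \<longleftrightarrow> (\<forall>i<r (N + 2). beta (r N) (r (N + 1)) i = f i) \<and> r (N + 3) = m" for r
  assume "loop_wins r"
  then have "Plus = Plus \<longrightarrow> \<not> inv r"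
  proof (rule scl_wins_loop_least[where Z = "\<lambda>r sg. sg = Plus \<longrightarrow> \<not> inv r", OF refutation_scl_addrs(1) claims_refer_refutation_scl, rotated])
    fix r sg assume ev: "scl_eval (\<lambda>r sg. sg = Plus \<longrightarrow> \<not> inv r) (Label 0 (round_scl N \<psi>)) r sg"
    show "sg = Plus \<longrightarrow> \<not> inv r"
    proof (intro impI notI)
      assume sg: "sg = Plus" and inv: "inv r"
      then have known: "f i = z" if "known N r i z" for i z
        using that by (auto simp: inv_def known_def)
      have "\<not> fo_sat (\<lambda>_. {}) r (refuted_fo N \<psi>)"
        using clash_mono[of "known N r" "\<lambda>i z. f i = z" N \<psi>] known f inv
        by (auto simp: fo_sat_refuted_fo[OF vars] inv_def)
      with ev sg have "reveal_step N (\<lambda>r. \<not> inv r) r" by (simp add: scl_eval_round)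
      then obtain c where c: "\<And>a b. (\<forall>i<r (N + 2). beta a b i = beta (r N) (r (N + 1)) i) \<Longrightarrow>
          \<not> inv (r(N + 4 := r N, N + 5 := r (N + 1), N + 6 := r (N + 2), N + 2 := c, N := a, N + 1 := b))"
        unfolding reveal_step_def by blast
      \<comment> \<open>\<open>c\<close> may be smaller than the old length, but the old entries
        must still agree; hence the maximum.\<close>
      obtain a b where ab: "\<And>i. i < max c (r (N + 2)) \<Longrightarrow> beta a b i = f i"
        using beta_sequence by metis
      with inv c[of a b] show False by (simp add: inv_def)
    qed
  qed
  with r show False by (simp add: inv_def)
qed

text \<open>If Eloise asks for one more entry in each round, then Abelard reveals a whole sequence.\<close>

lemma loop_wins_if_refuted:
  assumes refuted: "\<And>f. (\<exists>r. clash N (\<lambda>i z. f i = z) \<psi> r) \<or> f m \<noteq> 0"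
    and r: "r (N + 2) = 0" "r (N + 3) = m"
  shows "loop_wins r"
proof (rule ccontr)
  assume neg: "\<not> loop_wins r"
  define Q where "Q r r' \<longleftrightarrow> \<not> loop_wins r' \<and> r' (N + 2) = Suc (r (N + 2)) \<and> r' (N + 3) = r (N + 3) \<and>
      (\<forall>i<r (N + 2). beta (r' N) (r' (N + 1)) i = beta (r N) (r (N + 1)) i)" for r r'
  have "\<exists>r'. Q r r'" if "\<not> loop_wins r" for r
  proof -
    from that have "\<not> reveal_step N loop_wins r" using loop_wins_unfold by blast
    then obtain a b where ab: "\<forall>i<r (N + 2). beta a b i = beta (r N) (r (N + 1)) i"
      "\<not> loop_wins (r(N + 4 := r N, N + 5 := r (N + 1), N + 6 := r (N + 2),
         N + 2 := Suc (r (N + 2)), N := a, N + 1 := b))"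
      unfolding reveal_step_def by blast
    show ?thesis
      unfolding Q_def by (rule exI, rule conjI, rule ab(2)) (use ab(1) in simp)
  qed
  then obtain T where T: "\<And>r. \<not> loop_wins r \<Longrightarrow> Q r (T r)" by metis
  define R where "R n = (T ^^ n) r" for n
  have R: "\<not> loop_wins (R n) \<and> R n (N + 2) = n \<and> R n (N + 3) = m" for n
    by (induction n) (use neg r T in \<open>auto simp: R_def Q_def\<close>)
  \<comment> \<open>Entry \<open>i\<close> is read off at the first stage that reveals it; agreement
    preserves it afterwards.\<close>
  define f where "f i = beta (R (Suc i) N) (R (Suc i) (N + 1)) i" for i
  have beta: "beta (R n N) (R n (N + 1)) i = f i" if "i < n" for n i
    using that
  proof (induction n)
    case (Suc n)
    show ?case
    proof (cases "i = n")
      case False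
      with Suc have "i < n" by simp
      then have "beta (R (Suc n) N) (R (Suc n) (N + 1)) i = beta (R n N) (R n (N + 1)) i"
        using T[of "R n"] R[of n] by (simp add: R_def Q_def)
      with Suc \<open>i < n\<close> show ?thesis by simp
    qed (simp add: f_def)
  qed simp
  have known: "known N (R n) i z" if "i < n \<and> f i = z" for n i z
    using that R[of n] beta[of i n] by (simp add: known_def)
  have "\<exists>n. fo_sat (\<lambda>_. {}) (R n) (refuted_fo N \<psi>)"
  proof (cases "f m = 0")
    case True
    with refuted obtain r' where "clash N (\<lambda>i z. f i = z) \<psi> r'" by blast
    then obtain n where "clash N (\<lambda>i z. i < n \<and> f i = z) \<psi> r'" using clash_finite by blast
    then have "clash N (known N (R n)) \<psi> r'"
      by (rule clash_mono[rotated]) (rule known)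
    then show ?thesis unfolding fo_sat_refuted_fo[OF vars] by blast
  next
    case False
    moreover have "known N (R (Suc m)) (R (Suc m) (N + 3)) (f m)"
      using R[of "Suc m"] known[of m "Suc m" "f m"] by simp
    ultimately show ?thesis unfolding fo_sat_refuted_fo[OF vars] by blast
  qed
  with R loop_wins_unfold show False by blast
qed

lemma scl_sat_refutation_scl:
  assumes "length ms = k"
  shows "scl_sat (tuple_asg ms) (refutation_scl k N \<psi>) \<longleftrightarrow> (\<forall>I. fo_sat I (tuple_asg ms) \<psi>)"
proof -
  let ?s = "tuple_asg ms" and ?m = "fo_index N \<psi> (tuple_asg ms)"
  have "map (\<lambda>i. tm_val (?s(N := a, N + 1 := b, N + 2 := c, N + 3 := m)) (if i < k then Var i else Zero)) [0..<N]
      = map ?s [0..<N]" for a b c m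
    using assms k by (auto simp: tuple_asg_def)
  then have start: "fo_sat (\<lambda>_. {}) (?s(N := a, N + 1 := b, N + 2 := c, N + 3 := m)) (start_fo k N \<psi>) \<longleftrightarrow>
      c = 0 \<and> m = ?m" for a b c m
    by (simp add: start_fo_def comp_def del: map_eq_conv)
  let ?Z = "scl_wins (refutation_scl k N \<psi>) loop_addr"
  let ?t = "\<lambda>a b c m. ?s(N := a, N + 1 := b, N + 2 := c, N + 3 := m)"
  have "fo_rvars (start_fo k N \<psi>) = {}" by (simp add: start_fo_def)
  then have "scl_eval ?Z (refutation_scl k N \<psi>) ?s Plus \<longleftrightarrow> (\<exists>a b c m.
      fo_sat (\<lambda>_. {}) (?t a b c m) (start_fo k N \<psi>) \<and> scl_eval ?Z (round_scl N \<psi>) (?t a b c m) Plus)"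
    by (simp add: refutation_scl_def scl_eval_of_fo[where I = "\<lambda>_. {}"])
  moreover have "scl_eval ?Z (round_scl N \<psi>) r Plus \<longleftrightarrow> loop_wins r" for r
    by (subst scl_wins_eval[OF refutation_scl_addrs(1) claims_refer_refutation_scl])
      (simp only: scl_eval.simps)
  moreover have "scl_sat ?s (refutation_scl k N \<psi>) \<longleftrightarrow> scl_eval ?Z (refutation_scl k N \<psi>) ?s Plus"
    unfolding scl_sat_iff_wins by (rule scl_wins_eval[OF _ claims_refer_refutation_scl]) simp
  ultimately have "scl_sat ?s (refutation_scl k N \<psi>) \<longleftrightarrow> (\<exists>a b. loop_wins (?t a b 0 ?m))"
    (is "_ \<longleftrightarrow> ?wins")
    by (simp only: start) blast
  also have "?wins \<longleftrightarrow> (\<forall>f. (\<exists>r. clash N (\<lambda>i z. f i = z) \<psi> r) \<or> f ?m \<noteq> 0)"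
  proof
    assume ?wins
    then obtain a b where ab: "loop_wins (?t a b 0 ?m)" by blast
    show "\<forall>f. (\<exists>r. clash N (\<lambda>i z. f i = z) \<psi> r) \<or> f ?m \<noteq> 0"
    proof (rule ccontr)
      assume "\<not> ?thesis"
      then obtain f where "\<And>r. \<not> clash N (\<lambda>i z. f i = z) \<psi> r" "f ?m = 0" by blast
      from not_loop_wins[OF this, of "?t a b 0 ?m"] ab
      show False by simp
    qed
  next
    assume "\<forall>f. (\<exists>r. clash N (\<lambda>i z. f i = z) \<psi> r) \<or> f ?m \<noteq> 0"
    then have "loop_wins (?t 0 0 0 ?m)"
      by (intro loop_wins_if_refuted[where m = ?m]) auto
    then show ?wins by blast
  qed
  also have "\<dots> \<longleftrightarrow> (\<forall>I. fo_sat I ?s \<psi>)"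
    by (rule all_interpretations_iff_clash[OF wf core vars, symmetric])
  finally show ?thesis .
qed

lemma scl_fv_refutation_scl: "scl_fv (refutation_scl k N \<psi>) \<subseteq> {..<k}"
proof -
  have start: "fo_fv (start_fo k N \<psi>) \<subseteq> {..<k} \<union> {N + 2, N + 3}" "fo_rvars (start_fo k N \<psi>) = {}"
    by (auto simp: start_fo_def split: if_splits)
  have "scl_fv (round_scl N \<psi>) \<subseteq> {N..N + 3}"
    using refuted_fo_simps(2)[OF vars]
    by (auto simp: round_scl_def scl_fv_of_fo refuted_fo_simps agree_fo_simps vars_eq_fo_def)
  with start show ?thesis by (fastforce simp: refutation_scl_def scl_fv_of_fo)
qed

end

section \<open>Assembling the two directions\<close>

lemma finite_fo_vars: "finite (fo_vars \<phi>)"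
  by (induction \<phi>) auto

theorem Pi11_relation_imp_SCL_definable:
  assumes "Pi11_relation k X"
  shows "SCL_definable k X"
proof -
  from assms obtain \<Phi> where \<Phi>: "uso_wf \<Phi>" "uso_free_rvars \<Phi> = {}"
    and X: "\<And>m. length m = k \<Longrightarrow> m \<in> X \<longleftrightarrow> uso_sat (\<lambda>_. {}) (tuple_asg m) \<Phi>"
    unfolding Pi11_relation_def by blast
  define \<psi> where "\<psi> = fo_core (uso_matrix \<Phi>)"
  have \<psi>: "fo_wf \<psi>" "is_core \<psi>" using \<Phi> by (simp_all add: \<psi>_def uso_matrix_simps)
  obtain N where N: "k \<le> N" "fo_vars \<psi> \<subseteq> {..<N}"
    using finite_nat_set_bounded finite_fo_vars by metis
  have "m \<in> X \<longleftrightarrow> scl_sat (tuple_asg m) (refutation_scl k N \<psi>)" if "length m = k" for m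
    using X[OF that] uso_sat_closed_iff[OF \<Phi>] scl_sat_refutation_scl[OF \<psi> N(2,1) that]
    by (simp add: \<psi>_def)
  then show ?thesis
    unfolding SCL_definable_def using scl_fv_refutation_scl[OF \<psi> N(2,1)] by blast
qed

theorem theorem7p2:
  fixes k :: nat and X :: "nat list set"
  assumes "X \<subseteq> {m. length m = k}"
  shows "SCL_definable k X \<longleftrightarrow> Pi11_relation k X"
  using SCL_definable_imp_Pi11_relation Pi11_relation_imp_SCL_definable by blast

end
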